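(* Let $0<\varepsilon\le1$ and $0<\delta\le 1/10$. In the approximate-DP setting, Algorithm BoundedWeights (described in the context) is $(\varepsilon,3n^2\delta)$-differentially private, and in the pure-DP setting, Algorithm BoundedWeights is $(\varepsilon,0)$-differentially private.
   Context: Setting: $H=(V,E,W)$ is a weighted undirected graph with $|V|=n$ and edge weights in $(0,A]$; its unweighted topology $G=(V,E)$ is public. Two weighted graphs on the same topology are adjacent if $\sum_{e\in E}|w_e-w'_e|\le 1$; an algorithm is $(\varepsilon,\delta)$-DP if for all adjacent $H,H'$ and all output sets $S$, $\Pr[\mathcal{A}(H)\in S]\le e^\varepsilon\Pr[\mathcal{A}(H')\in S]+\delta$. $d(u,v)$ is weighted distance, $h$ hop distance, $B_{G'}(v,r)=\{u\in V(G'):h_{G'}(u,v)\le r\}$, $\log$ natural log, $Lap(b)$ has density $\frac1{2b}e^{-|x|/b}$, $Expo(R)$ is exponential with mean $R$; all random choices independent. Algorithm BoundedWeights$(H,\varepsilon,\delta)$: set $K=100\log n$, and (when $A\varepsilon n\ge1$) in the approximate-DP setting $T=n/(A\varepsilon n)^{\sqrt2-1}$, $R=n/(A\varepsilon n)^{2-\sqrt2}$, in the pure-DP setting $T=n/(A\varepsilon n)^{(\sqrt{17}-3)/4}$, $R=n/(A\varepsilon n)^{(5-\sqrt{17})/2}$ (so that $T<n$ for $n\ge2$), and $L=100\log n\cdot n/T$. If $n=1$ output the trivial answer. Otherwise repeat $K$ times independently (index $k$): (i) with $G'=G$, while some $v\in G'$ has $|B_{G'}(v,100R\log n)|\le T$,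 pick any such $v_t$, sample $r_t\sim Expo(R)$, let $B^{(t)}=B_{G'}(v_t,r_t)$ and remove it from $G'$; (ii) for each ball $B^{(t)}$, run BoundedWeights recursively $K$ times with fresh randomness on the induced weighted subgraph $H[B^{(t)}]$ with parameters $(\varepsilon/(3K^2),\delta/(3K^2))$ (with $\delta$-parameter $0$ in the pure-DP setting), and let $M^{(t)}$ be the entrywise median of the $K$ output matrices; (iii) pick a uniformly random $S\subset V$ of size $L$; (iv) build a multigraph $\tilde H$ on $V$ with: a red edge for each $(u,v)\in E$ of weight $w_{u,v}+Lap(3K/\varepsilon)$; a blue edge for each pair $u,v\in S$ of weight $d(u,v)+Lap(10KL\sqrt{\log(3K/\delta)}/\varepsilon)$ (in the pure-DP setting: $d(u,v)+Lap(10KL^2/\varepsilon)$); a green edge for each pair $u,v$ in the same ball $B^{(t)}$ of weight $M^{(t)}[u,v]$; (v) let $\tilde D^{(k)}[u,v]$ be the minimum length of a $u$–$v$ path in $\tilde H$ using at most $100R\log n+100T/R$ red edges, at most one blue edge and at most $100T/R$ green edges. Output the entrywise median $\tilde D$ of $\tilde D^{(1)},\dots,\tilde D^{(K)}$. *)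

theory Defs
  imports "HOL-Probability.Probability"
begin

section \<open>Weighted graphs on a public topology\<close>

text \<open>A topology is a finite vertex set \<open>V\<close> with a set \<open>E\<close> of two-element subsets of \<open>V\<close>.
  A weighting is a function \<open>w\<close> of which only the values on \<open>E\<close> matter.\<close>

definition simple_graph :: "'v set \<Rightarrow> 'v set set \<Rightarrow> bool" where
  "simple_graph V E \<longleftrightarrow> finite V \<and> (\<forall>e\<in>E. e \<subseteq> V \<and> card e = 2)"

definition bounded_weightings :: "'v set set \<Rightarrow> real \<Rightarrow> ('v set \<Rightarrow> real) set" where
  "bounded_weightings E A = {w. \<forall>e\<in>E. 0 < w e \<and> w e \<le> A}"

definition adjacent_weightings :: "'v set set \<Rightarrow> ('v set \<Rightarrow> real) \<Rightarrow> ('v set \<Rightarrow> real) \<Rightarrow> bool" where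
  "adjacent_weightings E w w' \<longleftrightarrow> (\<Sum>e\<in>E. \<bar>w e - w' e\<bar>) \<le> 1"

definition induced_edges :: "'v set set \<Rightarrow> 'v set \<Rightarrow> 'v set set" where
  "induced_edges E U = {e\<in>E. e \<subseteq> U}"

text \<open>Since all vertices of a path are required to lie in \<open>V\<close>, for \<open>V' \<subseteq> V\<close> the paths of
  \<open>(V', E)\<close> are exactly those of the subgraph induced on \<open>V'\<close>.\<close>

definition is_path :: "'v set \<Rightarrow> 'v set set \<Rightarrow> 'v \<Rightarrow> 'v \<Rightarrow> 'v list \<Rightarrow> bool" where
  "is_path V E u v p \<longleftrightarrow> p \<noteq> [] \<and> hd p = u \<and> last p = v \<and> distinct p \<and> set p \<subseteq> V \<and>
     (\<forall>i. Suc i < length p \<longrightarrow> {p ! i, p ! Suc i} \<in> E)"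

text \<open>Both distances are \<open>\<infinity>\<close> between different connected components.\<close>

definition hop_dist :: "'v set \<Rightarrow> 'v set set \<Rightarrow> 'v \<Rightarrow> 'v \<Rightarrow> ereal" where
  "hop_dist V E u v = (INF p\<in>{p. is_path V E u v p}. ereal (real (length p - 1)))"

definition weighted_dist :: "'v set \<Rightarrow> 'v set set \<Rightarrow> ('v set \<Rightarrow> real) \<Rightarrow> 'v \<Rightarrow> 'v \<Rightarrow> ereal" where
  "weighted_dist V E w u v =
     (INF p\<in>{p. is_path V E u v p}. ereal (\<Sum>i<length p - 1. w {p ! i, p ! Suc i}))"

definition hop_ball :: "'v set \<Rightarrow> 'v set set \<Rightarrow> 'v \<Rightarrow> real \<Rightarrow> 'v set" where
  "hop_ball V E v r = {u\<in>V. hop_dist V E u v \<le> ereal r}"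


section \<open>Differential privacy and noise\<close>

text \<open>A randomized algorithm maps every input in \<open>X\<close> to a probability distribution on the output
  space \<open>N\<close>; that it does so is made part of the definition.\<close>

definition differentially_private ::
    "'i set \<Rightarrow> ('i \<Rightarrow> 'i \<Rightarrow> bool) \<Rightarrow> 'o measure \<Rightarrow> ('i \<Rightarrow> 'o measure) \<Rightarrow> real \<Rightarrow> real \<Rightarrow> bool" where
  "differentially_private X adj N M \<epsilon> \<delta> \<longleftrightarrow>
     (\<forall>x\<in>X. prob_space (M x) \<and> sets (M x) = sets N) \<and>
     (\<forall>x\<in>X. \<forall>y\<in>X. adj x y \<longrightarrow>
        (\<forall>S\<in>sets N. measure (M x) S \<le> exp \<epsilon> * measure (M y) S + \<delta>))"

definition Lap :: "real \<Rightarrow> real measure" where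
  "Lap b = density lborel (\<lambda>x. ennreal (1 / (2 * b) * exp (- \<bar>x\<bar> / b)))"

text \<open>The library's exponential density is parametrized by the rate, which is the inverse of
  the mean.\<close>

definition Expo :: "real \<Rightarrow> real measure" where
  "Expo R = density lborel (\<lambda>x. ennreal (exponential_density (1 / R) x))"


section \<open>Parameters of the algorithm\<close>

datatype dp_setting = Approx_DP | Pure_DP

fun T_exponent :: "dp_setting \<Rightarrow> real" where
  "T_exponent Approx_DP = sqrt 2 - 1"
| "T_exponent Pure_DP = (sqrt 17 - 3) / 4"

fun R_exponent :: "dp_setting \<Rightarrow> real" where
  "R_exponent Approx_DP = 2 - sqrt 2"
| "R_exponent Pure_DP = (5 - sqrt 17) / 2"

definition T_param :: "dp_setting \<Rightarrow> real \<Rightarrow> real \<Rightarrow> nat \<Rightarrow> real" where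
  "T_param m A \<epsilon> n = real n / (A * \<epsilon> * real n) powr T_exponent m"

definition R_param :: "dp_setting \<Rightarrow> real \<Rightarrow> real \<Rightarrow> nat \<Rightarrow> real" where
  "R_param m A \<epsilon> n = real n / (A * \<epsilon> * real n) powr R_exponent m"

text \<open>The repetition count \<open>K\<close> and the sample size \<open>L\<close> have to be integers and are rounded up.\<close>

definition K_param :: "nat \<Rightarrow> nat" where
  "K_param n = nat \<lceil>100 * ln (real n)\<rceil>"

definition L_param :: "dp_setting \<Rightarrow> real \<Rightarrow> real \<Rightarrow> nat \<Rightarrow> nat" where
  "L_param m A \<epsilon> n = nat \<lceil>100 * ln (real n) * real n / T_param m A \<epsilon> n\<rceil>"

fun blue_scale :: "dp_setting \<Rightarrow> real \<Rightarrow> real \<Rightarrow> nat \<Rightarrow> nat \<Rightarrow> real" where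
  "blue_scale Approx_DP \<epsilon> \<delta> K L = 10 * real K * real L * sqrt (ln (3 * real K / \<delta>)) / \<epsilon>"
| "blue_scale Pure_DP \<epsilon> \<delta> K L = 10 * real K * (real L)\<^sup>2 / \<epsilon>"


section \<open>One repetition of the main loop\<close>

type_synonym 'v matrix = "'v \<times> 'v \<Rightarrow> ereal"

definition matrix_space :: "'v set \<Rightarrow> 'v matrix measure" where
  "matrix_space V = PiM (V \<times> V) (\<lambda>_. borel)"

text \<open>Median of \<open>f 0, \<dots>, f (k - 1)\<close>; for even \<open>k\<close> the mean of the two middle values.\<close>

definition median_of :: "nat \<Rightarrow> (nat \<Rightarrow> ereal) \<Rightarrow> ereal" where
  "median_of k f = (let xs = sort (map f [0..<k]) in (xs ! ((k - 1) div 2) + xs ! (k div 2)) / 2)"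

text \<open>The choice of the next centre is a rule \<open>pick\<close> which may look at the topology, at the balls
  removed so far and at the set of admissible centres, but not at the edge weights.\<close>

type_synonym 'v centre_rule = "'v set \<Rightarrow> 'v set set \<Rightarrow> 'v set list \<Rightarrow> 'v set \<Rightarrow> 'v"

definition admissible_centres :: "'v set \<Rightarrow> 'v set set \<Rightarrow> real \<Rightarrow> real \<Rightarrow> 'v set" where
  "admissible_centres V' E \<rho> T = {v\<in>V'. real (card (hop_ball V' E v \<rho>)) \<le> T}"

text \<open>The while loop, run for at most as many steps as its first argument says. Since
  \<open>r \<ge> 0\<close> almost surely, each step removes at least its centre, so that \<open>card V\<close> steps
  exhaust the loop almost surely.\<close>

primrec carve :: "nat \<Rightarrow> 'v centre_rule \<Rightarrow> 'v set \<Rightarrow> 'v set set \<Rightarrow> real \<Rightarrow> real \<Rightarrow> 'v set list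
    \<Rightarrow> 'v set list measure" where
  "carve 0 pick V E T R Bs = return (count_space UNIV) Bs"
| "carve (Suc s) pick V E T R Bs =
     (let V' = V - \<Union>(set Bs);
          C = admissible_centres V' E (100 * R * ln (real (card V))) T
      in if C = {} then return (count_space UNIV) Bs
         else Expo R \<bind> (\<lambda>r. carve s pick V E T R (Bs @ [hop_ball V' E (pick V E Bs C) r])))"

text \<open>The multigraph: for each colour, the length of the edge of that colour between
  \<open>u\<close> and \<open>v\<close>, where \<open>\<infinity>\<close> stands for the absence of such an edge. Red and blue noise is indexed
  by unordered pairs; \<open>mats t i\<close> is the output of the \<open>i\<close>-th recursive run on the ball \<open>Bs ! t\<close>.
  The balls being disjoint, the infimum in the green case is over at most one \<open>t\<close>.\<close>

datatype colour = Red | Blue | Green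

fun edge_length :: "'v set \<Rightarrow> 'v set set \<Rightarrow> ('v set \<Rightarrow> real) \<Rightarrow> nat \<Rightarrow> 'v set list \<Rightarrow> 'v set
    \<Rightarrow> ('v set \<Rightarrow> real) \<Rightarrow> ('v set \<Rightarrow> real) \<Rightarrow> (nat \<Rightarrow> nat \<Rightarrow> 'v matrix)
    \<Rightarrow> colour \<Rightarrow> 'v \<Rightarrow> 'v \<Rightarrow> ereal" where
  "edge_length V E w K Bs S red blue mats Red u v =
     (if {u, v} \<in> E then ereal (w {u, v} + red {u, v}) else \<infinity>)"
| "edge_length V E w K Bs S red blue mats Blue u v =
     (if u \<in> S \<and> v \<in> S \<and> u \<noteq> v then weighted_dist V E w u v + ereal (blue {u, v}) else \<infinity>)"
| "edge_length V E w K Bs S red blue mats Green u v =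
     (INF t\<in>{t. t < length Bs \<and> u \<in> Bs ! t \<and> v \<in> Bs ! t}. median_of K (\<lambda>i. mats t i (u, v)))"

text \<open>A path in the multigraph is given by its distinct vertices and the colours of its edges.\<close>

definition coloured_path :: "'v set \<Rightarrow> 'v \<Rightarrow> 'v \<Rightarrow> 'v list \<Rightarrow> colour list \<Rightarrow> bool" where
  "coloured_path V u v p c \<longleftrightarrow> p \<noteq> [] \<and> hd p = u \<and> last p = v \<and> distinct p \<and> set p \<subseteq> V \<and>
     length c = length p - 1"

definition restricted_dist :: "'v set \<Rightarrow> (colour \<Rightarrow> 'v \<Rightarrow> 'v \<Rightarrow> ereal) \<Rightarrow> real \<Rightarrow> real \<Rightarrow> 'v matrix" where
  "restricted_dist V len max_red max_green = (\<lambda>(u, v)\<in>V \<times> V.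
     INF (p, c)\<in>{(p, c). coloured_path V u v p c \<and> real (count_list c Red) \<le> max_red \<and>
                  count_list c Blue \<le> 1 \<and> real (count_list c Green) \<le> max_green}.
       (\<Sum>i<length c. len (c ! i) (p ! i) (p ! Suc i)))"

text \<open>Distribution of the distance matrix computed in one repetition; \<open>rec B\<close> is the output distribution of a recursive
  run on the ball \<open>B\<close>. When the sample size exceeds the number of vertices, the sample is all
  of \<open>V\<close>.\<close>

definition bw_round :: "dp_setting \<Rightarrow> real \<Rightarrow> 'v centre_rule \<Rightarrow> 'v set \<Rightarrow> 'v set set
    \<Rightarrow> ('v set \<Rightarrow> real) \<Rightarrow> real \<Rightarrow> real \<Rightarrow> ('v set \<Rightarrow> 'v matrix measure) \<Rightarrow> 'v matrix measure" where
  "bw_round m A pick V E w \<epsilon> \<delta> rec =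
     (let n = card V; K = K_param n; T = T_param m A \<epsilon> n; R = R_param m A \<epsilon> n;
          L = L_param m A \<epsilon> n
      in carve n pick V E T R [] \<bind> (\<lambda>Bs.
         measure_pmf (pmf_of_set {S. S \<subseteq> V \<and> card S = min L n}) \<bind> (\<lambda>S.
         distr
           (PiM E (\<lambda>_. Lap (3 * real K / \<epsilon>)) \<Otimes>\<^sub>M
            (PiM {e. e \<subseteq> S \<and> card e = 2} (\<lambda>_. Lap (blue_scale m \<epsilon> \<delta> K L)) \<Otimes>\<^sub>M
             PiM {..<length Bs} (\<lambda>t. PiM {..<K} (\<lambda>_. rec (Bs ! t)))))
           (matrix_space V)
           (\<lambda>(red, blue, mats).
              restricted_dist V (edge_length V E w K Bs S red blue mats)
                (100 * R * ln (real n) + 100 * T / R) (100 * T / R)))))"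


section \<open>The algorithm\<close>

text \<open>The parameters \<open>T\<close> and \<open>R\<close> are only specified for \<open>A \<epsilon> n \<ge> 1\<close>. For \<open>A \<epsilon> n < 1\<close>, a
  regime always reached by sufficiently deep recursion, the algorithm returns a matrix \<open>dflt\<close>
  depending only on the topology and the privacy parameters. The recursive calls terminate because
  \<open>\<epsilon>\<close> drops by the factor \<open>3 K\<^sup>2\<close> while the ball may, with positive probability, be all of \<open>V\<close>.
  In the pure setting, the algorithm is meant to be run with \<open>\<delta> = 0\<close>, which the recursion
  preserves.\<close>

type_synonym 'v default_rule = "'v set \<Rightarrow> 'v set set \<Rightarrow> real \<Rightarrow> real \<Rightarrow> 'v matrix"

function bounded_weights :: "dp_setting \<Rightarrow> real \<Rightarrow> 'v centre_rule \<Rightarrow> 'v default_rule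
    \<Rightarrow> 'v set \<Rightarrow> 'v set set \<Rightarrow> ('v set \<Rightarrow> real) \<Rightarrow> real \<Rightarrow> real \<Rightarrow> 'v matrix measure" where
  "bounded_weights m A pick dflt V E w \<epsilon> \<delta> =
     (if card V \<le> 1 then return (matrix_space V) (\<lambda>_\<in>V \<times> V. 0)
      else if A * \<epsilon> * real (card V) < 1
        then return (matrix_space V) (restrict (dflt V E \<epsilon> \<delta>) (V \<times> V))
      else
        distr
          (PiM {..<K_param (card V)} (\<lambda>_. bw_round m A pick V E w \<epsilon> \<delta>
             (\<lambda>B. bounded_weights m A pick dflt (V \<inter> B) (induced_edges E (V \<inter> B)) w
                    (\<epsilon> / (3 * (real (K_param (card V)))\<^sup>2)) (\<delta> / (3 * (real (K_param (card V)))\<^sup>2)))))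
          (matrix_space V)
          (\<lambda>D. \<lambda>uv\<in>V \<times> V. median_of (K_param (card V)) (\<lambda>k. D k uv)))"
  by pat_completeness auto

termination
proof (relation "Wellfounded.measure (\<lambda>(m, A, pick, dflt, V, E, w, \<epsilon>, \<delta>). nat \<lfloor>A * \<epsilon> * real (card V)\<rfloor>)",
    goal_cases)
  case 1
  show ?case by simp
next
  case (2 m A pick dflt V E w \<epsilon> \<delta> k B)
  define x where "x = A * \<epsilon> * real (card V)"
  define c where "c = 3 * (real (K_param (card V)))\<^sup>2"
  have n: "card V \<ge> 2" and x1: "x \<ge> 1" using 2 by (auto simp: x_def)
  have "ln (real (card V)) > 0" using n by simp
  then have "K_param (card V) \<ge> 1" unfolding K_param_def by linarith
  then have "(1::real)\<^sup>2 \<le> (real (K_param (card V)))\<^sup>2" by (intro power_mono) auto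
  then have c: "c \<ge> 3" by (simp add: c_def)
  have "finite V" using n card.infinite by force
  then have cB: "real (card (V \<inter> B)) \<le> real (card V)" by (simp add: card_mono)
  have "A * \<epsilon> > 0"
  proof (rule ccontr)
    assume "\<not> A * \<epsilon> > 0"
    then have "x \<le> 0" unfolding x_def by (simp add: mult_nonpos_nonneg)
    then show False using x1 by simp
  qed
  then have "A * \<epsilon> * real (card (V \<inter> B)) \<le> x"
    unfolding x_def using cB by (simp add: mult_left_mono)
  then have "A * \<epsilon> * real (card (V \<inter> B)) / c \<le> x / c"
    using c by (intro divide_right_mono) auto
  also have "x / c \<le> x / 3" using c x1 by (intro divide_left_mono) auto
  finally have le: "A * (\<epsilon> / c) * real (card (V \<inter> B)) \<le> x / 3" by simp
  have "nat \<lfloor>A * (\<epsilon> / c) * real (card (V \<inter> B))\<rfloor> < nat \<lfloor>x\<rfloor>"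
  proof -
    have "\<lfloor>y\<rfloor> < \<lfloor>x\<rfloor>" if "y \<le> x / 3" for y
    proof -
      have "of_int \<lfloor>y\<rfloor> \<le> y" "1 \<le> \<lfloor>x\<rfloor>" "x < of_int \<lfloor>x\<rfloor> + 1" using x1 by linarith+
      then have "3 * real_of_int \<lfloor>y\<rfloor> < real_of_int \<lfloor>x\<rfloor> + 1" using that by linarith
      then have "3 * \<lfloor>y\<rfloor> < \<lfloor>x\<rfloor> + 1" by linarith
      then show ?thesis using \<open>1 \<le> \<lfloor>x\<rfloor>\<close> by linarith
    qed
    from this[OF le] x1 show ?thesis by simp
  qed
  then show ?case by (simp add: x_def c_def)
qed

declare bounded_weights.simps [simp del]

end

theory Submission
  imports Defs
begin

text \<open>Two distributions \<open>P\<close>, \<open>Q\<close> are compared through all measurable \<open>f \<le> 1\<close>, by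
  \<open>\<integral> f \<partial>P \<le> exp a * \<integral> f \<partial>Q + d\<close>; in this form \<open>a\<close> and \<open>d\<close> add up over products.

  Adjacency is not inherited by a single ball: the unit of weight difference may be spread over many
  of them. The induction therefore proves a stronger bound, with \<open>a = \<epsilon> * s\<close> where \<open>s \<le> 1\<close> is the
  l1-distance of the two weightings. The balls being disjoint, their distances add up to at most
  \<open>s\<close>, so that the green edges cost \<open>\<epsilon> * s / (3 * K)\<close> per round. The red edges cost the same, each
  weight being released once with Laplace noise, and so do the blue ones, whose up to \<open>L\<^sup>2 / 2\<close>
  distances are \<open>s\<close>-sensitive: in the pure setting by adding up, in the approximate setting by a
  Chernoff bound for the total privacy loss, with failure probability \<open>\<delta> / (3 * K)\<close>. The additive
  errors of the recursive calls are at most \<open>n\<^sup>2 * \<delta> / K\<close> per round, since the squares of the sizes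
  of the balls add up to at most \<open>n\<^sup>2\<close>.\<close>


section \<open>Approximate closeness of distributions\<close>

text \<open>Functions rather than sets serve as tests, because integrating one coordinate out of an
  indicator on a product leaves a function with values between 0 and 1, and the bound for the other
  coordinate is applied to such a function. Extended nonnegative integrals avoid integrability
  conditions. Measurability refers to \<open>Q\<close>; where \<open>P\<close> has to share it,
  equality of the sigma-algebras is a separate hypothesis.\<close>

definition dp_close :: "real \<Rightarrow> real \<Rightarrow> 'a measure \<Rightarrow> 'a measure \<Rightarrow> bool" where
  "dp_close a d P Q \<longleftrightarrow> (\<forall>f\<in>borel_measurable Q. (\<forall>x. f x \<le> 1) \<longrightarrow>
     (\<integral>\<^sup>+x. f x \<partial>P) \<le> ennreal (exp a) * (\<integral>\<^sup>+x. f x \<partial>Q) + ennreal d)"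

lemma dp_closeD:
  assumes "dp_close a d P Q" "f \<in> borel_measurable Q" "\<And>x. f x \<le> 1"
  shows "(\<integral>\<^sup>+x. f x \<partial>P) \<le> ennreal (exp a) * (\<integral>\<^sup>+x. f x \<partial>Q) + ennreal d"
  using assms by (auto simp: dp_close_def)

lemma dp_close_refl: "dp_close 0 0 P P"
  by (simp add: dp_close_def)

lemma dp_close_mono:
  assumes "dp_close a d P Q" "a \<le> a'" "d \<le> d'"
  shows "dp_close a' d' P Q"
  unfolding dp_close_def
proof (intro ballI impI)
  fix f :: "_ \<Rightarrow> ennreal" assume f: "f \<in> borel_measurable Q" "\<forall>x. f x \<le> 1"
  have "(\<integral>\<^sup>+x. f x \<partial>P) \<le> ennreal (exp a) * (\<integral>\<^sup>+x. f x \<partial>Q) + ennreal d"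
    using dp_closeD[OF assms(1) f(1)] f(2) by blast
  also have "\<dots> \<le> ennreal (exp a') * (\<integral>\<^sup>+x. f x \<partial>Q) + ennreal d'"
    using assms(2,3) by (intro add_mono mult_right_mono ennreal_leI) auto
  finally show "(\<integral>\<^sup>+x. f x \<partial>P) \<le> \<dots>" .
qed

lemma dp_close_measure:
  assumes "dp_close a d P Q" "prob_space P" "prob_space Q" "sets P = sets Q" "S \<in> sets Q" "d \<ge> 0"
  shows "measure P S \<le> exp a * measure Q S + d"
proof -
  interpret P: prob_space P by fact
  interpret Q: prob_space Q by fact
  have "(\<integral>\<^sup>+x. indicator S x \<partial>P) \<le> ennreal (exp a) * (\<integral>\<^sup>+x. indicator S x \<partial>Q) + ennreal d"
    using assms by (intro dp_closeD) (auto simp: indicator_def)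
  then have "ennreal (measure P S) \<le> ennreal (exp a) * ennreal (measure Q S) + ennreal d"
    using assms by (simp add: P.emeasure_eq_measure Q.emeasure_eq_measure)
  also have "\<dots> = ennreal (exp a * measure Q S + d)"
    using \<open>d \<ge> 0\<close> by (simp add: ennreal_mult' ennreal_plus)
  finally show ?thesis using \<open>d \<ge> 0\<close> by (simp flip: ennreal_plus)
qed

lemma dp_close_distr:
  assumes "dp_close a d P Q" "f \<in> measurable Q N" "sets P = sets Q"
  shows "dp_close a d (distr P N f) (distr Q N f)"
  unfolding dp_close_def
proof (intro ballI impI)
  fix g :: "_ \<Rightarrow> ennreal" assume g: "g \<in> borel_measurable (distr Q N f)" "\<forall>x. g x \<le> 1"
  have P: "f \<in> measurable P N" using assms(2,3) measurable_cong_sets by blast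
  have "(\<lambda>x. g (f x)) \<in> borel_measurable Q" using g assms(2) by simp
  then show "(\<integral>\<^sup>+x. g x \<partial>distr P N f) \<le> ennreal (exp a) * (\<integral>\<^sup>+x. g x \<partial>distr Q N f) + ennreal d"
    using dp_closeD[OF assms(1), of "\<lambda>x. g (f x)"] g assms(2) P by (simp add: nn_integral_distr)
qed

text \<open>Capping \<open>exp a2 * h\<close> at 1 is what makes the additive errors add up without a factor
  \<open>exp a1\<close>.\<close>

lemma dp_close_compose:
  fixes g h :: "_ \<Rightarrow> ennreal"
  assumes "dp_close a1 d1 P Q" "prob_space P" "sets P = sets Q"
    and h: "h \<in> borel_measurable Q"
    and gh: "\<And>x. x \<in> space P \<Longrightarrow> g x \<le> ennreal (exp a2) * h x + ennreal d2"
    and g1: "\<And>x. x \<in> space P \<Longrightarrow> g x \<le> 1"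
    and d: "d1 \<ge> 0" "d2 \<ge> 0"
  shows "(\<integral>\<^sup>+x. g x \<partial>P) \<le> ennreal (exp (a1 + a2)) * (\<integral>\<^sup>+x. h x \<partial>Q) + ennreal (d1 + d2)"
proof -
  interpret P: prob_space P by fact
  let ?m = "\<lambda>x. min 1 (ennreal (exp a2) * h x)"
  have m: "?m \<in> borel_measurable Q" using h by measurable
  then have mP: "?m \<in> borel_measurable P" using assms(3) measurable_cong_sets by blast
  \<comment> \<open>Where the cap is active, \<open>g1\<close> bounds \<open>g x\<close> by 1;
    elsewhere \<open>gh\<close> applies.\<close>
  have "g x \<le> ?m x + ennreal d2" if "x \<in> space P" for x
    using gh[OF that] g1[OF that] by (auto simp: min_def intro: order_trans[of _ 1])
  then have "(\<integral>\<^sup>+x. g x \<partial>P) \<le> (\<integral>\<^sup>+x. ?m x + ennreal d2 \<partial>P)"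
    by (intro nn_integral_mono) auto
  also have "\<dots> = (\<integral>\<^sup>+x. ?m x \<partial>P) + ennreal d2"
    using mP by (subst nn_integral_add) (auto simp: P.emeasure_space_1)
  also have "\<dots> \<le> (ennreal (exp a1) * (\<integral>\<^sup>+x. ?m x \<partial>Q) + ennreal d1) + ennreal d2"
    using m by (intro add_right_mono dp_closeD[OF assms(1)]) auto
  also have "\<dots> \<le> (ennreal (exp a1) * (\<integral>\<^sup>+x. ennreal (exp a2) * h x \<partial>Q) + ennreal d1) + ennreal d2"
    by (intro add_right_mono mult_left_mono nn_integral_mono) auto
  also have "\<dots> = ennreal (exp (a1 + a2)) * (\<integral>\<^sup>+x. h x \<partial>Q) + ennreal (d1 + d2)"
    using h d by (simp add: nn_integral_cmult exp_add ennreal_mult' ennreal_plus mult.assoc add.assoc)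
  finally show ?thesis .
qed

section \<open>Composition over products and mixtures\<close>

lemma (in prob_space) nn_integral_le_1:
  fixes f :: "_ \<Rightarrow> ennreal"
  assumes "\<And>x. x \<in> space M \<Longrightarrow> f x \<le> 1"
  shows "(\<integral>\<^sup>+x. f x \<partial>M) \<le> 1"
proof -
  have "(\<integral>\<^sup>+x. f x \<partial>M) \<le> (\<integral>\<^sup>+x. 1 \<partial>M)" using assms by (intro nn_integral_mono) auto
  then show ?thesis by (simp add: emeasure_space_1)
qed

text \<open>By Fubini, the second factors are compared for each fixed value of the first coordinate;
  \<open>dp_close_compose\<close> then passes from \<open>P1\<close> to \<open>Q1\<close>.\<close>

lemma dp_close_pair:
  assumes c: "dp_close a1 d1 P1 Q1" "dp_close a2 d2 P2 Q2"
    and p: "prob_space P1" "prob_space P2" "prob_space Q2"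
    and s: "sets P1 = sets Q1" "sets P2 = sets Q2" and d: "d1 \<ge> 0" "d2 \<ge> 0"
  shows "dp_close (a1 + a2) (d1 + d2) (P1 \<Otimes>\<^sub>M P2) (Q1 \<Otimes>\<^sub>M Q2)"
  unfolding dp_close_def
proof (intro ballI impI)
  interpret P2: prob_space P2 by fact
  interpret Q2: prob_space Q2 by fact
  fix f :: "_ \<Rightarrow> ennreal" assume f[measurable]: "f \<in> borel_measurable (Q1 \<Otimes>\<^sub>M Q2)" and f1: "\<forall>x. f x \<le> 1"
  have sp: "sets (P1 \<Otimes>\<^sub>M P2) = sets (Q1 \<Otimes>\<^sub>M Q2)" using s by (rule sets_pair_measure_cong)
  have fP: "f \<in> borel_measurable (P1 \<Otimes>\<^sub>M P2)" using f sp measurable_cong_sets by blast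
  have "(\<integral>\<^sup>+x. f x \<partial>(P1 \<Otimes>\<^sub>M P2)) = (\<integral>\<^sup>+x. \<integral>\<^sup>+y. f (x, y) \<partial>P2 \<partial>P1)"
    using P2.nn_integral_fst[OF fP] by simp
  also have "\<dots> \<le> ennreal (exp (a1 + a2)) * (\<integral>\<^sup>+x. \<integral>\<^sup>+y. f (x, y) \<partial>Q2 \<partial>Q1) + ennreal (d1 + d2)"
  proof (rule dp_close_compose[OF c(1) p(1) s(1) _ _ _ d])
    show "(\<lambda>x. \<integral>\<^sup>+y. f (x, y) \<partial>Q2) \<in> borel_measurable Q1" by measurable
    fix x assume "x \<in> space P1"
    then have [measurable]: "x \<in> space Q1" using s(1) sets_eq_imp_space_eq by blast
    show "(\<integral>\<^sup>+y. f (x, y) \<partial>P2) \<le> ennreal (exp a2) * (\<integral>\<^sup>+y. f (x, y) \<partial>Q2) + ennreal d2"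
      using f1 by (intro dp_closeD[OF c(2)]) auto
    show "(\<integral>\<^sup>+y. f (x, y) \<partial>P2) \<le> 1" using f1 by (intro P2.nn_integral_le_1) auto
  qed
  also have "(\<integral>\<^sup>+x. \<integral>\<^sup>+y. f (x, y) \<partial>Q2 \<partial>Q1) = (\<integral>\<^sup>+x. f x \<partial>(Q1 \<Otimes>\<^sub>M Q2))"
    using Q2.nn_integral_fst[OF f] by simp
  finally show "(\<integral>\<^sup>+x. f x \<partial>(P1 \<Otimes>\<^sub>M P2)) \<le> ennreal (exp (a1 + a2)) * (\<integral>\<^sup>+x. f x \<partial>(Q1 \<Otimes>\<^sub>M Q2)) + ennreal (d1 + d2)" .
qed

text \<open>Basic composition of independent releases: coordinates are split off one at a time, the
  new one being the inner integral in \<open>dp_close_compose\<close>. The factors are probability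
  spaces for all indices, also outside \<open>I\<close>, as the locale
  \<open>product_prob_space\<close> demands.\<close>

lemma dp_close_PiM:
  assumes "finite I" and "\<And>i. i \<in> I \<Longrightarrow> dp_close (a i) (d i) (P i) (Q i)" and d: "\<And>i. i \<in> I \<Longrightarrow> d i \<ge> 0"
    and p: "\<And>i. prob_space (P i)" "\<And>i. prob_space (Q i)" and s: "\<And>i. sets (P i) = sets (Q i)"
  shows "dp_close (\<Sum>i\<in>I. a i) (\<Sum>i\<in>I. d i) (PiM I P) (PiM I Q)"
  using assms(1-3)
proof (induction I)
  case empty
  have "PiM {} P = PiM {} Q" by (simp add: PiM_empty)
  then show ?case by (simp add: dp_close_refl)
next
  case (insert i I)
  interpret P: product_prob_space P by (rule product_prob_spaceI) (rule p)
  interpret Q: product_prob_space Q by (rule product_prob_spaceI) (rule p)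
  interpret PI: prob_space "PiM I P" by (rule prob_space_PiM) (rule p)
  have sI: "sets (PiM J P) = sets (PiM J Q)" for J by (intro sets_PiM_cong s refl)
  show ?case
    unfolding dp_close_def
  proof (intro ballI impI)
    fix f :: "_ \<Rightarrow> ennreal" assume f[measurable]: "f \<in> borel_measurable (PiM (insert i I) Q)" and f1: "\<forall>x. f x \<le> 1"
    have fP: "f \<in> borel_measurable (PiM (insert i I) P)" using f sI measurable_cong_sets by blast
    have "(\<integral>\<^sup>+x. f x \<partial>(PiM (insert i I) P)) = (\<integral>\<^sup>+x. \<integral>\<^sup>+y. f (x(i := y)) \<partial>P i \<partial>PiM I P)"
      using insert fP by (intro P.product_nn_integral_insert)
    also have "\<dots> \<le> ennreal (exp (sum a I + a i)) * (\<integral>\<^sup>+x. \<integral>\<^sup>+y. f (x(i := y)) \<partial>Q i \<partial>PiM I Q)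
        + ennreal (sum d I + d i)"
    proof (rule dp_close_compose[OF _ PI.prob_space_axioms sI])
      show "dp_close (sum a I) (sum d I) (PiM I P) (PiM I Q)" using insert by auto
      show "(\<lambda>x. \<integral>\<^sup>+y. f (x(i := y)) \<partial>Q i) \<in> borel_measurable (PiM I Q)" by measurable
      fix x assume "x \<in> space (PiM I P)"
      then have "x \<in> space (PiM I Q)" using sI sets_eq_imp_space_eq by blast
      then have "(\<lambda>y. f (x(i := y))) \<in> borel_measurable (Q i)" by measurable
      then show "(\<integral>\<^sup>+y. f (x(i := y)) \<partial>P i) \<le> ennreal (exp (a i)) * (\<integral>\<^sup>+y. f (x(i := y)) \<partial>Q i) + ennreal (d i)"
        using f1 insert.prems by (intro dp_closeD[where P="P i" and Q="Q i"]) auto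
      show "(\<integral>\<^sup>+y. f (x(i := y)) \<partial>P i) \<le> 1" using f1 by (intro prob_space.nn_integral_le_1[OF p(1)]) auto
    qed (use insert.prems in \<open>auto intro: sum_nonneg\<close>)
    also have "(\<integral>\<^sup>+x. \<integral>\<^sup>+y. f (x(i := y)) \<partial>Q i \<partial>PiM I Q) = (\<integral>\<^sup>+x. f x \<partial>(PiM (insert i I) Q))"
      using insert f by (intro Q.product_nn_integral_insert[symmetric])
    finally show "(\<integral>\<^sup>+x. f x \<partial>(PiM (insert i I) P)) \<le> ennreal (exp (sum a (insert i I))) * (\<integral>\<^sup>+x. f x \<partial>(PiM (insert i I) Q)) + ennreal (sum d (insert i I))"
      using insert by (simp add: add.commute)
  qed
qed

text \<open>A random choice with the same law \<open>M\<close> on both sides costs nothing: the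
  bounds for the single outcomes are averaged. The form with \<open>AE\<close> is what later allows
  the balls to be taken as disjoint and the sample as small.\<close>

lemma dp_close_bind:
  assumes M: "prob_space M" and f: "f \<in> measurable M (prob_algebra N)" and g: "g \<in> measurable M (prob_algebra N)"
    and c: "AE x in M. dp_close a d (f x) (g x)"
  shows "dp_close a d (M \<bind> f) (M \<bind> g)"
  unfolding dp_close_def
proof (intro ballI impI)
  interpret prob_space M by fact
  note f' = measurable_prob_algebraD[OF f] and g' = measurable_prob_algebraD[OF g]
  fix h :: "_ \<Rightarrow> ennreal" assume h: "h \<in> borel_measurable (M \<bind> g)" and h1: "\<forall>x. h x \<le> 1"
  have "sets (M \<bind> g) = sets N"
    using sets_kernel[OF g'] not_empty by (intro sets_bind) auto
  then have hN[measurable]: "h \<in> borel_measurable N" using h measurable_cong_sets by blast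
  have [measurable]: "(\<lambda>x. \<integral>\<^sup>+y. h y \<partial>g x) \<in> borel_measurable M"
    by (rule measurable_compose[OF g' nn_integral_measurable_subprob_algebra[OF hN]])
  have "(\<integral>\<^sup>+x. h x \<partial>(M \<bind> f)) = (\<integral>\<^sup>+x. \<integral>\<^sup>+y. h y \<partial>f x \<partial>M)"
    by (rule nn_integral_bind[OF hN f'])
  also have "\<dots> \<le> (\<integral>\<^sup>+x. ennreal (exp a) * (\<integral>\<^sup>+y. h y \<partial>g x) + ennreal d \<partial>M)"
  proof (intro nn_integral_mono_AE, use c AE_space in eventually_elim)
    case (elim x)
    have "h \<in> borel_measurable (g x)" using hN sets_kernel[OF g' elim(2)] measurable_cong_sets by blast
    then show ?case using dp_closeD[OF elim(1)] h1 by blast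
  qed
  also have "\<dots> = ennreal (exp a) * (\<integral>\<^sup>+x. \<integral>\<^sup>+y. h y \<partial>g x \<partial>M) + ennreal d"
    by (subst nn_integral_add) (auto simp: nn_integral_cmult emeasure_space_1)
  also have "(\<integral>\<^sup>+x. \<integral>\<^sup>+y. h y \<partial>g x \<partial>M) = (\<integral>\<^sup>+x. h x \<partial>(M \<bind> g))"
    by (rule nn_integral_bind[OF hN g', symmetric])
  finally show "(\<integral>\<^sup>+x. h x \<partial>(M \<bind> f)) \<le> ennreal (exp a) * (\<integral>\<^sup>+x. h x \<partial>(M \<bind> g)) + ennreal d" .
qed


section \<open>Laplace noise and the privacy loss\<close>

text \<open>The Laplace density is the average of the exponential density with mean \<open>b\<close>
  and its mirror image.\<close>

lemma nn_integral_Lap_density: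
  assumes "b > 0"
  shows "(\<integral>\<^sup>+x. ennreal (1 / (2 * b) * exp (- \<bar>x\<bar> / b)) \<partial>lborel) = 1"
proof -
  let ?e = "\<lambda>x. ennreal (exponential_density (1 / b) x)"
  interpret prob_space "density lborel (exponential_density (1 / b))"
    by (rule prob_space_exponential_density) (use assms in simp)
  have e1: "(\<integral>\<^sup>+x. ?e x \<partial>lborel) = 1"
    using emeasure_space_1 by (simp add: emeasure_density)
  have e2: "(\<integral>\<^sup>+x. ?e (- x) \<partial>lborel) = 1"
    using nn_integral_real_affine[of ?e "-1" 0] e1 by simp
  \<comment> \<open>At 0 both exponential densities are positive and their average is twice the
    Laplace density; this affects a null set only.\<close>
  have ae: "AE x in lborel. x \<noteq> (0::real)"
    by (rule AE_lborel_singleton)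
  have "(\<integral>\<^sup>+x. ennreal (1 / (2 * b) * exp (- \<bar>x\<bar> / b)) \<partial>lborel) =
        (\<integral>\<^sup>+x. ennreal (1/2) * ?e x + ennreal (1/2) * ?e (- x) \<partial>lborel)"
  proof (intro nn_integral_cong_AE, use ae in eventually_elim)
    case (elim x)
    have "1 / (2 * b) * exp (- \<bar>x\<bar> / b) =
        1/2 * exponential_density (1 / b) x + 1/2 * exponential_density (1 / b) (- x)"
      using elim by (cases "x < 0") (simp_all add: exponential_density_def)
    then show ?case
      using assms by (simp only:) (simp add: ennreal_plus ennreal_mult exponential_density_nonneg del: times_divide_eq_left)
  qed
  also have "\<dots> = ennreal (1/2) * 1 + ennreal (1/2) * 1"
    by (subst nn_integral_add) (auto simp: nn_integral_cmult e1 e2)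
  also have "\<dots> = ennreal (1/2 + 1/2)" by (subst ennreal_plus) auto
  finally show ?thesis by simp
qed

lemma prob_space_Lap: "b > 0 \<Longrightarrow> prob_space (Lap b)"
  using nn_integral_Lap_density[of b] by (intro prob_spaceI) (simp add: Lap_def emeasure_density)

lemma sets_Lap [simp, measurable_cong]: "sets (Lap b) = sets borel"
  by (simp add: Lap_def)

lemma distr_Lap_shift:
  "distr (Lap b) borel ((+) c) = density lborel (\<lambda>x. ennreal (1 / (2 * b) * exp (- \<bar>x - c\<bar> / b)))"
proof -
  have "density (distr lborel borel ((+) c)) (\<lambda>x. ennreal (1 / (2 * b) * exp (- \<bar>x - c\<bar> / b))) =
        distr (density lborel (\<lambda>x. ennreal (1 / (2 * b) * exp (- \<bar>c + x - c\<bar> / b)))) borel ((+) c)"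
    by (rule density_distr) auto
  then show ?thesis by (simp add: lborel_distr_plus Lap_def)
qed

text \<open>The exponent is the privacy loss at output \<open>y\<close>. By the triangle inequality
  its absolute value is at most \<open>\<bar>c - c'\<bar> / b\<close>.\<close>

lemma distr_Lap_shift_density:
  assumes "b > 0"
  shows "distr (Lap b) borel ((+) c) =
    density (distr (Lap b) borel ((+) c')) (\<lambda>y. ennreal (exp ((\<bar>y - c'\<bar> - \<bar>y - c\<bar>) / b)))"
  unfolding distr_Lap_shift
  using assms
  by (subst density_density_eq)
     (auto intro!: density_cong simp: diff_divide_distrib simp flip: ennreal_mult' exp_add)

text \<open>It suffices to compare both measures on boxes, where the density and the indicator
  factor over the coordinates. With exponentials as densities, the privacy loss of a product becomes
  a sum of independent terms.\<close>

lemma PiM_density: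
  fixes z :: "'i \<Rightarrow> 'a \<Rightarrow> ennreal"
  assumes I: "finite I" and p: "\<And>i. prob_space (P i)" "\<And>i. prob_space (Q i)"
    and z: "\<And>i. z i \<in> borel_measurable (Q i)"
    and P: "\<And>i. P i = density (Q i) (z i)"
  shows "PiM I P = density (PiM I Q) (\<lambda>x. \<Prod>i\<in>I. z i (x i))"
proof -
  interpret P: product_prob_space P by (rule product_prob_spaceI) (rule p)
  interpret Q: product_prob_space Q by (rule product_prob_spaceI) (rule p)
  have s: "sets (P i) = sets (Q i)" for i by (simp add: P)
  note z[measurable]
  have "density (PiM I Q) (\<lambda>x. \<Prod>i\<in>I. z i (x i)) = PiM I P"
  proof (rule P.PiM_eqI[OF I])
    show "sets (density (PiM I Q) (\<lambda>x. \<Prod>i\<in>I. z i (x i))) = sets (PiM I P)"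
      using s by (simp cong: sets_PiM_cong)
    fix A assume A: "\<And>i. i \<in> I \<Longrightarrow> A i \<in> sets (P i)"
    then have A'[measurable]: "\<And>i. i \<in> I \<Longrightarrow> A i \<in> sets (Q i)" by (simp add: s)
    have AI: "PiE I A \<in> sets (PiM I Q)" using I A' by (intro sets_PiM_I_finite) auto
    have "emeasure (density (PiM I Q) (\<lambda>x. \<Prod>i\<in>I. z i (x i))) (PiE I A) =
        (\<integral>\<^sup>+x. (\<Prod>i\<in>I. z i (x i)) * indicator (PiE I A) x \<partial>PiM I Q)"
      by (intro emeasure_density AI) measurable
    also have "\<dots> = (\<integral>\<^sup>+x. (\<Prod>i\<in>I. z i (x i) * indicator (A i) (x i)) \<partial>PiM I Q)"
    proof (rule nn_integral_cong)
      \<comment> \<open>Points of the product space are extensional, so lying in the box is a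
        condition on the coordinates in \<open>I\<close> alone.\<close>
      fix x assume "x \<in> space (PiM I Q)"
      then have "x \<in> extensional I" by (simp add: space_PiM PiE_def)
      then show "(\<Prod>i\<in>I. z i (x i)) * indicator (PiE I A) x = (\<Prod>i\<in>I. z i (x i) * indicator (A i) (x i))"
        using I by (auto simp: indicator_def PiE_def Pi_def prod_zero_iff)
    qed
    also have "\<dots> = (\<Prod>i\<in>I. \<integral>\<^sup>+x. z i x * indicator (A i) x \<partial>Q i)"
      using I by (intro Q.product_nn_integral_prod) auto
    also have "\<dots> = (\<Prod>i\<in>I. emeasure (P i) (A i))"
      using A' by (intro prod.cong) (auto simp: P emeasure_density)
    finally show "emeasure (density (PiM I Q) (\<lambda>x. \<Prod>i\<in>I. z i (x i))) (PiE I A) = (\<Prod>i\<in>I. emeasure (P i) (A i))" .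
  qed
  then show ?thesis ..
qed

text \<open>The preimage of a box under a componentwise map is a box, and boxes determine a product
  measure. This identifies independently shifted noise with the image of the unshifted noise under
  one map.\<close>

lemma distr_PiM_componentwise:
  assumes I: "finite I" and p: "\<And>i. prob_space (M i)" and f: "\<And>i. f i \<in> measurable (M i) (N i)"
  shows "distr (PiM I M) (PiM I N) (\<lambda>x. \<lambda>i\<in>I. f i (x i)) = PiM I (\<lambda>i. distr (M i) (N i) (f i))"
proof -
  interpret M: product_prob_space M by (rule product_prob_spaceI) (rule p)
  interpret D: product_prob_space "\<lambda>i. distr (M i) (N i) (f i)"
    by (rule product_prob_spaceI) (intro prob_space.prob_space_distr p f)
  note f[measurable]
  have meas: "(\<lambda>x. \<lambda>i\<in>I. f i (x i)) \<in> measurable (PiM I M) (PiM I N)" by measurable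
  show ?thesis
  proof (rule D.PiM_eqI[OF I])
    show "sets (distr (PiM I M) (PiM I N) (\<lambda>x. \<lambda>i\<in>I. f i (x i))) = sets (PiM I (\<lambda>i. distr (M i) (N i) (f i)))"
      by (simp cong: sets_PiM_cong)
    fix A assume A: "\<And>i. i \<in> I \<Longrightarrow> A i \<in> sets (distr (M i) (N i) (f i))"
    then have AI: "PiE I A \<in> sets (PiM I N)" using I by (intro sets_PiM_I_finite) auto
    have "emeasure (distr (PiM I M) (PiM I N) (\<lambda>x. \<lambda>i\<in>I. f i (x i))) (PiE I A) =
        emeasure (PiM I M) ((\<lambda>x. \<lambda>i\<in>I. f i (x i)) -` PiE I A \<inter> space (PiM I M))"
      using meas AI by (rule emeasure_distr)
    also have "(\<lambda>x. \<lambda>i\<in>I. f i (x i)) -` PiE I A \<inter> space (PiM I M) = (\<Pi>\<^sub>E i\<in>I. f i -` A i \<inter> space (M i))"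
      by (auto simp: space_PiM PiE_iff)
    also have "emeasure (PiM I M) \<dots> = (\<Prod>i\<in>I. emeasure (M i) (f i -` A i \<inter> space (M i)))"
      using A I f by (intro M.emeasure_PiM) (auto intro: measurable_sets)
    also have "\<dots> = (\<Prod>i\<in>I. emeasure (distr (M i) (N i) (f i)) (A i))"
      using A f by (intro prod.cong) (auto simp: emeasure_distr)
    finally show "emeasure (distr (PiM I M) (PiM I N) (\<lambda>x. \<lambda>i\<in>I. f i (x i))) (PiE I A) = \<dots>" .
  qed
qed

text \<open>Hoeffding's lemma with exponent \<open>-1\<close> bounds the mean of the privacy loss, because
  \<open>exp (- z)\<close> has mean 1.\<close>

lemma (in prob_space) privacy_loss_mgf:
  fixes z :: "'a \<Rightarrow> real"
  assumes z[measurable]: "z \<in> borel_measurable M" and b: "\<And>x. x \<in> space M \<Longrightarrow> \<bar>z x\<bar> \<le> c"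
    and one: "(\<integral>\<^sup>+x. ennreal (exp (- z x)) \<partial>M) = 1" and l: "l > 0"
  shows "(\<integral>\<^sup>+x. ennreal (exp (l * z x)) \<partial>M) \<le> ennreal (exp (c\<^sup>2 * (l + l\<^sup>2) / 2))"
proof -
  interpret z: interval_bounded_random_variable M z "- c" c
    using b by unfold_locales (auto simp: abs_le_iff minus_le_iff)
  interpret nz: interval_bounded_random_variable M "\<lambda>x. - z x" "- c" c
    using b by unfold_locales (auto simp: abs_le_iff minus_le_iff)
  define \<mu> where "\<mu> = expectation z"
  have n: "expectation (\<lambda>x. - z x) = - \<mu>" by (simp add: \<mu>_def)
  have c4: "(c - - c)\<^sup>2 / 8 = c\<^sup>2 / 2" by (simp add: power2_eq_square field_simps)
  have "(\<integral>\<^sup>+x. ennreal (exp (1 * (- z x - (- \<mu>)))) \<partial>M) \<le> ennreal (exp (1\<^sup>2 * (c - - c)\<^sup>2 / 8))"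
    using nz.Hoeffdings_lemma_nn_integral[of 1] unfolding n by simp
  also have "(\<integral>\<^sup>+x. ennreal (exp (1 * (- z x - (- \<mu>)))) \<partial>M) = (\<integral>\<^sup>+x. ennreal (exp \<mu>) * ennreal (exp (- z x)) \<partial>M)"
    by (intro nn_integral_cong) (simp flip: ennreal_mult' exp_add)
  also have "\<dots> = ennreal (exp \<mu>)" using one by (subst nn_integral_cmult) auto
  finally have \<mu>: "\<mu> \<le> c\<^sup>2 / 2" using c4 by simp
  have "(\<integral>\<^sup>+x. ennreal (exp (l * z x)) \<partial>M) = (\<integral>\<^sup>+x. ennreal (exp (l * \<mu>)) * ennreal (exp (l * (z x - \<mu>))) \<partial>M)"
    by (intro nn_integral_cong) (simp add: algebra_simps flip: ennreal_mult' exp_add)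
  also have "\<dots> = ennreal (exp (l * \<mu>)) * (\<integral>\<^sup>+x. ennreal (exp (l * (z x - \<mu>))) \<partial>M)"
    by (rule nn_integral_cmult) measurable
  \<comment> \<open>The first factor comes from the bound on the mean, the second from Hoeffding's
    lemma for the deviation from it; both have the constant \<open>c^2 / 2\<close>.\<close>
  also have "\<dots> \<le> ennreal (exp (l * (c\<^sup>2 / 2))) * ennreal (exp (l\<^sup>2 * (c - - c)\<^sup>2 / 8))"
    using \<mu> l z.Hoeffdings_lemma_nn_integral[OF l] unfolding \<mu>_def by (intro mult_mono ennreal_leI) auto
  also have "\<dots> = ennreal (exp (c\<^sup>2 * (l + l\<^sup>2) / 2))"
    by (simp add: power2_eq_square algebra_simps add_divide_distrib flip: ennreal_mult' exp_add)
  finally show ?thesis .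
qed

text \<open>Advanced composition in Chernoff form. Where the total loss \<open>Z\<close> is at most
  \<open>a\<close>, the density is at most \<open>exp a\<close>. The rest has \<open>P\<close>-mass
  at most the mean of \<open>exp (l * (Z - a))\<close>, which factors over the independent
  coordinates. The choice of \<open>l\<close> is left to the application.\<close>

lemma dp_close_PiM_advanced:
  fixes z :: "'i \<Rightarrow> 'a \<Rightarrow> real"
  assumes I: "finite I" and p: "\<And>i. prob_space (P i)" "\<And>i. prob_space (Q i)"
    and z: "\<And>i. z i \<in> borel_measurable (Q i)"
    and P: "\<And>i. P i = density (Q i) (\<lambda>y. ennreal (exp (z i y)))"
    and b: "\<And>i y. i \<in> I \<Longrightarrow> \<bar>z i y\<bar> \<le> c" and l: "l > 0"
  shows "dp_close a (exp (real (card I) * c\<^sup>2 * (l + l\<^sup>2) / 2 - l * a)) (PiM I P) (PiM I Q)"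
  unfolding dp_close_def
proof (intro ballI impI)
  interpret P: product_prob_space P by (rule product_prob_spaceI) (rule p)
  interpret Q: product_prob_space Q by (rule product_prob_spaceI) (rule p)
  define Z where "Z x = (\<Sum>i\<in>I. z i (x i))" for x
  note z[measurable]
  have s: "sets (P i) = sets (Q i)" for i by (simp add: P)
  have zP[measurable]: "z i \<in> borel_measurable (P i)" for i by (simp add: P)
  have ZQ[measurable]: "Z \<in> borel_measurable (PiM I Q)" unfolding Z_def by measurable
  have sI: "sets (PiM I P) = sets (PiM I Q)" by (intro sets_PiM_cong s refl)
  have ZP[measurable]: "Z \<in> borel_measurable (PiM I P)" unfolding Z_def by measurable
  have dens: "PiM I P = density (PiM I Q) (\<lambda>x. ennreal (exp (Z x)))"
    using PiM_density[OF I p _ P] by (simp add: Z_def exp_sum[OF I] prod_ennreal)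
  fix f :: "('i \<Rightarrow> 'a) \<Rightarrow> ennreal" assume f[measurable]: "f \<in> borel_measurable (PiM I Q)" and f1: "\<forall>x. f x \<le> 1"
  have fP[measurable]: "f \<in> borel_measurable (PiM I P)" using f sI measurable_cong_sets by blast
  \<comment> \<open>Where \<open>Z x > a\<close>, the exponential summand is at least 1 and so
    dominates \<open>f x\<close>; elsewhere the first summand already equals
    \<open>f x\<close>.\<close>
  have "(\<integral>\<^sup>+x. f x \<partial>PiM I P) \<le> (\<integral>\<^sup>+x. f x * indicator {x\<in>space (PiM I Q). Z x \<le> a} x + ennreal (exp (l * Z x - l * a)) \<partial>PiM I P)"
  proof (rule nn_integral_mono)
    fix x assume "x \<in> space (PiM I P)"
    then have x: "x \<in> space (PiM I Q)" using sets_eq_imp_space_eq[OF sI] by simp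
    show "f x \<le> f x * indicator {x\<in>space (PiM I Q). Z x \<le> a} x + ennreal (exp (l * Z x - l * a))"
    proof (cases "Z x \<le> a")
      case False
      then have "1 \<le> exp (l * Z x - l * a)" using l by simp
      then have "1 \<le> ennreal (exp (l * Z x - l * a))" by (simp add: ennreal_leI flip: ennreal_1)
      then have "f x \<le> ennreal (exp (l * Z x - l * a))" using f1 order_trans by blast
      then show ?thesis using False by simp
    qed (use x in simp)
  qed
  also have "\<dots> = (\<integral>\<^sup>+x. f x * indicator {x\<in>space (PiM I Q). Z x \<le> a} x \<partial>PiM I P) + (\<integral>\<^sup>+x. ennreal (exp (l * Z x - l * a)) \<partial>PiM I P)"
  proof (rule nn_integral_add)
    show "(\<lambda>x. f x * indicator {x\<in>space (PiM I Q). Z x \<le> a} x) \<in> borel_measurable (PiM I P)"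
      unfolding measurable_cong_sets[OF sI refl] by measurable
  qed measurable
  also have "(\<integral>\<^sup>+x. f x * indicator {x\<in>space (PiM I Q). Z x \<le> a} x \<partial>PiM I P) =
      (\<integral>\<^sup>+x. ennreal (exp (Z x)) * (f x * indicator {x\<in>space (PiM I Q). Z x \<le> a} x) \<partial>PiM I Q)"
    unfolding dens by (rule nn_integral_density) measurable
  also have "\<dots> \<le> (\<integral>\<^sup>+x. ennreal (exp a) * f x \<partial>PiM I Q)"
    by (intro nn_integral_mono) (auto simp: indicator_def intro!: mult_right_mono ennreal_leI)
  also have "\<dots> = ennreal (exp a) * (\<integral>\<^sup>+x. f x \<partial>PiM I Q)"
    by (rule nn_integral_cmult) measurable
  also have "(\<integral>\<^sup>+x. ennreal (exp (l * Z x - l * a)) \<partial>PiM I P) =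
      (\<integral>\<^sup>+x. ennreal (exp (- l * a)) * (\<Prod>i\<in>I. ennreal (exp (l * z i (x i)))) \<partial>PiM I P)"
  proof (intro nn_integral_cong)
    fix x
    have "exp (l * Z x - l * a) = exp (- l * a) * (\<Prod>i\<in>I. exp (l * z i (x i)))"
      by (simp add: Z_def sum_distrib_left flip: exp_sum[OF I] exp_add)
    then show "ennreal (exp (l * Z x - l * a)) = ennreal (exp (- l * a)) * (\<Prod>i\<in>I. ennreal (exp (l * z i (x i))))"
      by (simp add: ennreal_mult prod_ennreal prod_nonneg)
  qed
  also have "\<dots> = ennreal (exp (- l * a)) * (\<integral>\<^sup>+x. (\<Prod>i\<in>I. ennreal (exp (l * z i (x i)))) \<partial>PiM I P)"
    by (rule nn_integral_cmult) measurable
  also have "(\<integral>\<^sup>+x. (\<Prod>i\<in>I. ennreal (exp (l * z i (x i)))) \<partial>PiM I P) = (\<Prod>i\<in>I. \<integral>\<^sup>+x. ennreal (exp (l * z i x)) \<partial>P i)"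
    using I by (intro P.product_nn_integral_prod) auto
  also have "\<dots> \<le> (\<Prod>i\<in>I. ennreal (exp (c\<^sup>2 * (l + l\<^sup>2) / 2)))"
  proof (intro prod_mono_ennreal prob_space.privacy_loss_mgf[OF p(1)] zP b l)
    \<comment> \<open>Passing from \<open>P i\<close> to \<open>Q i\<close> multiplies by
      \<open>exp (z i x)\<close>, which cancels the integrand; this is the mean 1 that
      \<open>privacy_loss_mgf\<close> requires.\<close>
    fix i
    have "(\<integral>\<^sup>+x. ennreal (exp (- z i x)) \<partial>P i) = (\<integral>\<^sup>+x. ennreal (exp (z i x)) * ennreal (exp (- z i x)) \<partial>Q i)"
      by (subst P, rule nn_integral_density) measurable
    also have "\<dots> = (\<integral>\<^sup>+x. 1 \<partial>Q i)" by (intro nn_integral_cong) (simp flip: ennreal_mult' exp_add)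
    finally show "(\<integral>\<^sup>+x. ennreal (exp (- z i x)) \<partial>P i) = 1"
      using prob_space.emeasure_space_1[OF p(2)] by simp
  qed
  also have "\<dots> = ennreal (exp (real (card I) * (c\<^sup>2 * (l + l\<^sup>2) / 2)))"
    by (simp add: ennreal_power flip: exp_of_nat_mult)
  also have "ennreal (exp (- l * a)) * \<dots> = ennreal (exp (real (card I) * c\<^sup>2 * (l + l\<^sup>2) / 2 - l * a))"
    by (simp add: algebra_simps flip: ennreal_mult' exp_add)
  finally show "(\<integral>\<^sup>+x. f x \<partial>PiM I P) \<le> ennreal (exp a) * (\<integral>\<^sup>+x. f x \<partial>PiM I Q) +
      ennreal (exp (real (card I) * c\<^sup>2 * (l + l\<^sup>2) / 2 - l * a))"
    by (simp add: add_mono mult_left_mono)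
qed

lemma dp_close_density:
  fixes z :: "'a \<Rightarrow> real"
  assumes z[measurable]: "z \<in> borel_measurable Q" and b: "\<And>y. z y \<le> c"
  shows "dp_close c 0 (density Q (\<lambda>y. ennreal (exp (z y)))) Q"
  unfolding dp_close_def
proof (intro ballI impI)
  fix f :: "'a \<Rightarrow> ennreal" assume f[measurable]: "f \<in> borel_measurable Q"
  have "(\<integral>\<^sup>+x. f x \<partial>density Q (\<lambda>y. ennreal (exp (z y)))) = (\<integral>\<^sup>+x. ennreal (exp (z x)) * f x \<partial>Q)"
    by (rule nn_integral_density) measurable
  also have "\<dots> \<le> (\<integral>\<^sup>+x. ennreal (exp c) * f x \<partial>Q)"
    using b by (intro nn_integral_mono mult_right_mono ennreal_leI) auto
  finally show "(\<integral>\<^sup>+x. f x \<partial>density Q (\<lambda>y. ennreal (exp (z y)))) \<le> ennreal (exp c) * (\<integral>\<^sup>+x. f x \<partial>Q) + ennreal 0"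
    by (simp add: nn_integral_cmult)
qed


section \<open>Measurability and the carving of balls\<close>

text \<open>The entries up to \<open>a\<close> form a prefix of a sorted list. The right-hand side
  only counts entries, so that it does not change when the list is permuted.\<close>

lemma sorted_nth_le_iff:
  assumes "sorted xs" "j < length xs"
  shows "xs ! j \<le> a \<longleftrightarrow> j < length (filter (\<lambda>x. x \<le> a) xs)"
  using assms
proof (induction xs arbitrary: j)
  case (Cons x xs)
  show ?case
  proof (cases "x \<le> a")
    case True
    then show ?thesis using Cons by (cases j) auto
  next
    case False
    then have "filter (\<lambda>x. x \<le> a) xs = []" using Cons.prems by (auto simp: filter_empty_conv)
    moreover have "x \<le> (x # xs) ! j" using Cons.prems by (cases j) auto
    ultimately show ?thesis using False by auto
  qed
qed simp

text \<open>An order statistic is at most \<open>a\<close> exactly if more than \<open>j\<close> of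
  the values are, and this count is a finite sum of indicators of measurable events.\<close>

lemma measurable_sort_nth:
  fixes f :: "nat \<Rightarrow> 'a \<Rightarrow> ereal"
  assumes f[measurable]: "\<And>i. i < k \<Longrightarrow> f i \<in> borel_measurable M" and j: "j < k"
  shows "(\<lambda>x. sort (map (\<lambda>i. f i x) [0..<k]) ! j) \<in> borel_measurable M"
proof (rule borel_measurableI_le)
  fix a
  have "sort (map (\<lambda>i. f i x) [0..<k]) ! j \<le> a \<longleftrightarrow> real j < (\<Sum>i<k. if f i x \<le> a then 1 else 0)" for x
  proof -
    have "sort (map (\<lambda>i. f i x) [0..<k]) ! j \<le> a \<longleftrightarrow>
        j < length (filter (\<lambda>y. y \<le> a) (sort (map (\<lambda>i. f i x) [0..<k])))"
      using j by (intro sorted_nth_le_iff) auto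
    also have "length (filter (\<lambda>y. y \<le> a) (sort (map (\<lambda>i. f i x) [0..<k]))) =
        size (filter_mset (\<lambda>y. y \<le> a) (mset (sort (map (\<lambda>i. f i x) [0..<k]))))"
      by (metis mset_filter size_mset)
    also have "\<dots> = length (filter (\<lambda>y. y \<le> a) (map (\<lambda>i. f i x) [0..<k]))"
      by (metis mset_sort mset_filter size_mset)
    also have "\<dots> = card {i\<in>{..<k}. f i x \<le> a}"
      by (simp add: length_filter_conv_card lessThan_def) (intro arg_cong[where f=card] Collect_cong conj_cong; simp)
    also have "j < \<dots> \<longleftrightarrow> real j < (\<Sum>i\<in>{i\<in>{..<k}. f i x \<le> a}. 1)" by simp
    also have "(\<Sum>i\<in>{i\<in>{..<k}. f i x \<le> a}. 1 :: real) = (\<Sum>i<k. if f i x \<le> a then 1 else 0)"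
      by (rule sum.inter_filter) simp
    finally show ?thesis .
  qed
  moreover have "{x\<in>space M. real j < (\<Sum>i<k. if f i x \<le> a then 1 else 0)} \<in> sets M"
    by measurable
  ultimately show "{x\<in>space M. sort (map (\<lambda>i. f i x) [0..<k]) ! j \<le> a} \<in> sets M" by simp
qed

lemma measurable_median_of:
  fixes f :: "nat \<Rightarrow> 'a \<Rightarrow> ereal"
  assumes f: "\<And>i. i < k \<Longrightarrow> f i \<in> borel_measurable M" and k: "k > 0"
  shows "(\<lambda>x. median_of k (\<lambda>i. f i x)) \<in> borel_measurable M"
  unfolding median_of_def Let_def
  using k by (intro borel_measurable_ereal_divide borel_measurable_ereal_add measurable_sort_nth f) auto

section \<open>Finiteness of path sets and measurability of path minima\<close>

lemma finite_is_path:
  assumes "finite V"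
  shows "finite {p. is_path V E u v p}"
proof (rule finite_subset)
  show "{p. is_path V E u v p} \<subseteq> {p. set p \<subseteq> V \<and> length p \<le> card V}"
    using assms by (auto simp: is_path_def distinct_card[symmetric] intro: card_mono)
  show "finite {p. set p \<subseteq> V \<and> length p \<le> card V}" using assms by (rule finite_lists_length_le)
qed

lemma finite_coloured_path:
  assumes "finite V"
  shows "finite {(p, c). coloured_path V u v p c}"
proof (rule finite_subset)
  have "(UNIV :: colour set) = {Red, Blue, Green}" using colour.exhaust by blast
  then have "finite (UNIV :: colour set)" by (metis finite.emptyI finite_insert)
  then show "finite ({p. set p \<subseteq> V \<and> length p \<le> card V} \<times> {c :: colour list. set c \<subseteq> UNIV \<and> length c \<le> card V})"
    using assms by (intro finite_cartesian_product finite_lists_length_le) auto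
  have "length p \<le> card V" if "coloured_path V u v p c" for p c
    using that assms by (auto simp: coloured_path_def distinct_card[symmetric] intro: card_mono)
  then show "{(p, c). coloured_path V u v p c} \<subseteq>
      {p. set p \<subseteq> V \<and> length p \<le> card V} \<times> {c :: colour list. set c \<subseteq> UNIV \<and> length c \<le> card V}"
    by (force simp: coloured_path_def)
qed

text \<open>Each entry is an infimum over finitely many coloured paths of finite sums. All vertices
  of these paths lie in \<open>V\<close>, so only edge lengths between vertices of \<open>V\<close>
  have to be measurable.\<close>

lemma measurable_restricted_dist:
  assumes V: "finite V"
    and len: "\<And>c u v. u \<in> V \<Longrightarrow> v \<in> V \<Longrightarrow> (\<lambda>x. len x c u v) \<in> borel_measurable M"
  shows "(\<lambda>x. restricted_dist V (len x) r g) \<in> measurable M (matrix_space V)"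
  unfolding restricted_dist_def matrix_space_def
proof (rule measurable_restrict)
  fix uv assume "uv \<in> V \<times> V"
  obtain u v where uv: "uv = (u, v)" by force
  let ?I = "{(p, c). coloured_path V u v p c \<and> real (count_list c Red) \<le> r \<and>
                  count_list c Blue \<le> 1 \<and> real (count_list c Green) \<le> g}"
  have "?I \<subseteq> {(p, c). coloured_path V u v p c}" by auto
  then have "finite ?I" using finite_coloured_path[OF V] finite_subset by blast
  then have "countable ?I" by (rule countable_finite)
  then have "(\<lambda>x. INF pc\<in>?I. case pc of (p, c) \<Rightarrow> \<Sum>i<length c. len x (c ! i) (p ! i) (p ! Suc i)) \<in> borel_measurable M"
  proof (rule borel_measurable_INF)
    fix pc assume "pc \<in> ?I"
    then obtain p c where pc: "pc = (p, c)" and cp: "coloured_path V u v p c" by auto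
    have "p ! i \<in> V" "p ! Suc i \<in> V" if "i < length c" for i
      using that cp by (auto simp: coloured_path_def intro!: subsetD[of "set p" V] nth_mem)
    then have "(\<lambda>x. \<Sum>i<length c. len x (c ! i) (p ! i) (p ! Suc i)) \<in> borel_measurable M"
      by (intro borel_measurable_ereal_sum len) auto
    then show "(\<lambda>x. case pc of (p, c) \<Rightarrow> \<Sum>i<length c. len x (c ! i) (p ! i) (p ! Suc i)) \<in> borel_measurable M"
      by (simp add: pc)
  qed
  then show "(\<lambda>x. case uv of (u, v) \<Rightarrow> INF (p, c)\<in>{(p, c). coloured_path V u v p c \<and> real (count_list c Red) \<le> r \<and>
                  count_list c Blue \<le> 1 \<and> real (count_list c Green) \<le> g}.
       (\<Sum>i<length c. len x (c ! i) (p ! i) (p ! Suc i))) \<in> borel_measurable M"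
    by (simp add: uv)
qed

text \<open>Only finitely many sets can occur as values, and the radii giving a particular set
  \<open>B\<close> are described by one threshold condition for every vertex.\<close>

lemma measurable_hop_ball:
  assumes V: "finite V"
  shows "hop_ball V E v \<in> measurable borel (count_space UNIV)"
proof -
  have "hop_ball V E v \<in> measurable borel (count_space (Pow V))"
    unfolding measurable_count_space_eq2[OF finite_Pow_iff[THEN iffD2, OF V]]
  proof (intro conjI ballI)
    show "hop_ball V E v \<in> space borel \<rightarrow> Pow V" by (auto simp: hop_ball_def)
    fix B assume B: "B \<in> Pow V"
    have "hop_ball V E v r = B \<longleftrightarrow> (\<forall>u\<in>V. (hop_dist V E u v \<le> ereal r) = (u \<in> B))" for r
      using B by (fastforce simp: hop_ball_def set_eq_iff)
    then have "hop_ball V E v -` {B} \<inter> space borel =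
        (\<Inter>u\<in>V. {r\<in>space borel. (hop_dist V E u v \<le> ereal r) = (u \<in> B)}) \<inter> space borel"
      by auto
    also have "\<dots> \<in> sets borel"
    proof (cases "V = {}")
      case False
      have "{r\<in>space borel. (hop_dist V E u v \<le> ereal r) = (u \<in> B)} \<in> sets borel" for u by measurable
      then show ?thesis using V False by (intro sets.Int sets.finite_INT) auto
    qed simp
    finally show "hop_ball V E v -` {B} \<inter> space borel \<in> sets borel" .
  qed
  then have "(\<lambda>r. id (hop_ball V E v r)) \<in> measurable borel (count_space UNIV)"
    by (rule measurable_compose) simp
  then show ?thesis by simp
qed

lemma prob_space_Expo:
  assumes "R > 0"
  shows "prob_space (Expo R)"
  unfolding Expo_def using assms by (intro prob_space_exponential_density) simp

lemma sets_Expo [simp, measurable_cong]: "sets (Expo R) = sets borel"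
  by (simp add: Expo_def)

text \<open>Membership in \<open>space (prob_algebra N)\<close> combines being a probability measure
  with having the sigma-algebra of \<open>N\<close>, which are the two demands of
  \<open>differentially_private\<close> on a single output distribution.\<close>

lemma bind_in_space_prob_algebra:
  assumes M: "prob_space M" and f: "f \<in> measurable M (prob_algebra N)"
  shows "M \<bind> f \<in> space (prob_algebra N)"
proof -
  have "M \<in> space (prob_algebra M)" using M by (simp add: space_prob_algebra)
  then show ?thesis using f by (simp add: space_prob_algebra prob_space_bind' sets_bind')
qed

lemma measurable_from_count_space:
  assumes "\<And>x. f x \<in> space (prob_algebra N)"
  shows "f \<in> measurable (count_space UNIV) (prob_algebra N)"
  using assms by simp

text \<open>Every set of lists is measurable, so only the dependence of the new ball on the radius
  has to be examined. The assumption \<open>carve\<close> is the induction hypothesis of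
  \<open>carve_in_space\<close>.\<close>

lemma carve_kernel:
  assumes V: "finite V" and R: "R > 0"
    and carve: "\<And>Bs. carve s pick V E T R Bs \<in> space (prob_algebra (count_space UNIV))"
  shows "(\<lambda>r. carve s pick V E T R (Bs @ [hop_ball (V - U) E v r])) \<in> measurable (Expo R) (prob_algebra (count_space UNIV))"
proof -
  have "hop_ball (V - U) E v \<in> measurable (Expo R) (count_space UNIV)"
    using measurable_hop_ball[of "V - U"] V by simp
  then show ?thesis
    by (rule measurable_compose[where f = "hop_ball (V - U) E v"]) (rule measurable_from_count_space, rule carve)
qed

lemma carve_in_space:
  assumes V: "finite V" and R: "R > 0"
  shows "carve s pick V E T R Bs \<in> space (prob_algebra (count_space UNIV))"
proof (induction s arbitrary: Bs)
  case 0
  then show ?case by (simp add: space_prob_algebra prob_space_return)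
next
  case (Suc s)
  have "prob_space (return (count_space UNIV) Bs)" by (simp add: prob_space_return)
  then show ?case
    using bind_in_space_prob_algebra[OF prob_space_Expo[OF R] carve_kernel[OF V R Suc]]
    by (simp add: Let_def space_prob_algebra)
qed

text \<open>Positions are compared instead of sets, since the later sums run over positions: a
  nonempty ball cannot occur twice, whereas the empty ball of a negative radius may.\<close>

definition disjoint_balls :: "'v set \<Rightarrow> 'v set list \<Rightarrow> bool" where
  "disjoint_balls V Bs \<longleftrightarrow> (\<forall>B\<in>set Bs. B \<subseteq> V) \<and>
     (\<forall>i<length Bs. \<forall>j<length Bs. i \<noteq> j \<longrightarrow> Bs ! i \<inter> Bs ! j = {})"

text \<open>A new ball is a subset of what the earlier ones have left over, whatever its centre and
  radius; the invariant thus passes through each step of the loop.\<close>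

lemma AE_carve_disjoint:
  assumes V: "finite V" and R: "R > 0" and "disjoint_balls V Bs"
  shows "AE Bs' in carve s pick V E T R Bs. disjoint_balls V Bs'"
  using assms(3)
proof (induction s arbitrary: Bs)
  case 0
  then show ?case unfolding carve.simps by (subst AE_return) auto
next
  case (Suc s)
  have "disjoint_balls V (Bs @ [hop_ball (V - \<Union>(set Bs)) E v r])" for v r
  proof -
    let ?H = "hop_ball (V - \<Union>(set Bs)) E v r"
    have sub: "?H \<subseteq> V - \<Union>(set Bs)" by (auto simp: hop_ball_def)
    then have "?H \<inter> Bs ! i = {}" if "i < length Bs" for i using nth_mem[OF that] by blast
    then have "(Bs @ [?H]) ! i \<inter> (Bs @ [?H]) ! j = {}" if "i < Suc (length Bs)" "j < Suc (length Bs)" "i \<noteq> j" for i j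
      using that Suc.prems by (cases "i < length Bs"; cases "j < length Bs") (auto simp: disjoint_balls_def nth_append Int_commute)
    then show ?thesis
      using sub Suc.prems by (auto simp: disjoint_balls_def)
  qed
  then have "AE Bs' in carve s pick V E T R (Bs @ [hop_ball (V - \<Union>(set Bs)) E v r]). disjoint_balls V Bs'" for v r
    by (rule Suc.IH)
  then have "AE Bs' in Expo R \<bind> (\<lambda>r. carve s pick V E T R (Bs @ [hop_ball (V - \<Union>(set Bs)) E v r])). disjoint_balls V Bs'" for v
    by (subst AE_bind[OF measurable_prob_algebraD[OF carve_kernel[OF V R carve_in_space[OF V R]]]]) auto
  moreover have "AE Bs' in return (count_space UNIV) Bs. disjoint_balls V Bs'"
    using Suc.prems by (subst AE_return) auto
  ultimately show ?case unfolding carve.simps Let_def by (split if_split) blast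
qed


section \<open>Weights, distances and noisy edge lengths\<close>

definition path_weight :: "('v set \<Rightarrow> real) \<Rightarrow> 'v list \<Rightarrow> real" where
  "path_weight w p = (\<Sum>i<length p - 1. w {p ! i, p ! Suc i})"

definition edge_l1 :: "'v set set \<Rightarrow> ('v set \<Rightarrow> real) \<Rightarrow> ('v set \<Rightarrow> real) \<Rightarrow> real" where
  "edge_l1 E w w' = (\<Sum>e\<in>E. \<bar>w e - w' e\<bar>)"

lemma edge_l1_nonneg: "edge_l1 E w w' \<ge> 0"
  by (simp add: edge_l1_def sum_nonneg)

text \<open>The vertices of a path are distinct, so it uses no edge twice, and the changes along it
  are different terms of the l1-distance.\<close>

lemma path_weight_le:
  assumes p: "is_path V E u v p" and E: "finite E"
  shows "path_weight w p \<le> path_weight w' p + edge_l1 E w w'"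
proof -
  let ?e = "\<lambda>i. {p ! i, p ! Suc i}" and ?I = "{..<length p - 1}"
  have d: "distinct p" using p by (simp add: is_path_def)
  have "inj_on ?e ?I"
    using d by (auto simp: inj_on_def doubleton_eq_iff nth_eq_iff_index_eq)
  moreover have "?e ` ?I \<subseteq> E" using p by (auto simp: is_path_def)
  ultimately have "(\<Sum>i\<in>?I. \<bar>w (?e i) - w' (?e i)\<bar>) \<le> edge_l1 E w w'"
    unfolding edge_l1_def using E
    by (subst sum.reindex[of ?e ?I "\<lambda>e. \<bar>w e - w' e\<bar>", unfolded comp_def, symmetric]) (auto intro: sum_mono2)
  moreover have "path_weight w p - path_weight w' p \<le> (\<Sum>i\<in>?I. \<bar>w (?e i) - w' (?e i)\<bar>)"
    unfolding path_weight_def sum_subtractf[symmetric] by (intro sum_mono) auto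
  ultimately show ?thesis by linarith
qed

section \<open>Symmetry, attainment and sensitivity of the weighted distance\<close>

lemma is_path_rev: "is_path V E u v p \<Longrightarrow> is_path V E v u (rev p)"
  unfolding is_path_def
proof (intro conjI allI impI; (elim conjE)?)
  fix i assume *: "\<forall>i. Suc i < length p \<longrightarrow> {p ! i, p ! Suc i} \<in> E" and i: "Suc i < length (rev p)"
  have "Suc (length p - Suc (Suc i)) = length p - Suc i" using i by auto
  then have "{p ! (length p - Suc (Suc i)), p ! (length p - Suc i)} \<in> E"
    using *[rule_format, of "length p - Suc (Suc i)"] i by auto
  then show "{rev p ! i, rev p ! Suc i} \<in> E" using i by (simp add: rev_nth insert_commute)
qed (auto simp: hd_rev last_rev)

lemma path_weight_rev: "path_weight w (rev p) = path_weight w p"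
proof -
  have "path_weight w (rev p) = (\<Sum>i<length p - 1. w {p ! (length p - 1 - Suc i), p ! Suc (length p - 1 - Suc i)})"
    unfolding path_weight_def
  proof (intro sum.cong)
    fix i assume "i \<in> {..<length p - 1}"
    then have "Suc (length p - 1 - Suc i) = length p - Suc i" "length p - 1 - Suc i = length p - Suc (Suc i)"
      "Suc i < length p" by auto
    then show "w {rev p ! i, rev p ! Suc i} = w {p ! (length p - 1 - Suc i), p ! Suc (length p - 1 - Suc i)}"
      by (simp add: rev_nth insert_commute)
  qed simp
  also have "\<dots> = path_weight w p"
    unfolding path_weight_def by (rule sum.nat_diff_reindex)
  finally show ?thesis .
qed

lemma weighted_dist_eq: "weighted_dist V E w u v = (INF p\<in>{p. is_path V E u v p}. ereal (path_weight w p))"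
  by (simp add: weighted_dist_def path_weight_def)

lemma weighted_dist_commute: "weighted_dist V E w u v = weighted_dist V E w v u"
proof -
  have "weighted_dist V E w v u \<le> weighted_dist V E w u v" for u v
    unfolding weighted_dist_eq
    by (rule INF_mono) (metis is_path_rev mem_Collect_eq path_weight_rev order_refl)
  then show ?thesis by (meson antisym)
qed

lemma weighted_dist_infinite: "\<nexists>p. is_path V E u v p \<Longrightarrow> weighted_dist V E w u v = \<infinity>"
  by (simp add: weighted_dist_def top_ereal_def)

lemma weighted_dist_attained:
  assumes "finite V" "is_path V E u v p0"
  obtains p where "is_path V E u v p" "weighted_dist V E w u v = ereal (path_weight w p)"
proof -
  let ?A = "(\<lambda>p. ereal (path_weight w p)) ` {p. is_path V E u v p}"
  have A: "finite ?A" "?A \<noteq> {}" using finite_is_path[OF assms(1), of E u v] assms(2) by auto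
  then have "Inf ?A \<in> ?A" using Min_in[OF A] cInf_eq_Min[OF A] by simp
  then show thesis using that by (auto simp: weighted_dist_eq)
qed

text \<open>The noise is indexed by unordered pairs, so the distances have to be, too; pairs in different
  components get the junk value \<open>real_of_ereal \<infinity> = 0\<close>.\<close>

definition pair_dist :: "'v set \<Rightarrow> 'v set set \<Rightarrow> ('v set \<Rightarrow> real) \<Rightarrow> 'v set \<Rightarrow> real" where
  "pair_dist V E w e = real_of_ereal (case SOME (u, v). e = {u, v} of (u, v) \<Rightarrow> weighted_dist V E w u v)"

text \<open>\<open>SOME\<close> yields the pair in one of its two orders, and the distance is
  symmetric.\<close>

lemma pair_dist_eq: "pair_dist V E w {u, v} = real_of_ereal (weighted_dist V E w u v)"
proof -
  obtain a b where ab: "(SOME (a, b). {u, v} = {a, b}) = (a, b)" by force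
  have "case (a, b) of (a, b) \<Rightarrow> {u, v} = {a, b}"
    unfolding ab[symmetric] by (rule someI[of _ "(u, v)"]) simp
  then have "weighted_dist V E w a b = weighted_dist V E w u v"
    using weighted_dist_commute by (auto simp: doubleton_eq_iff)
  then show ?thesis by (simp add: pair_dist_def ab)
qed

lemma weighted_dist_pair_dist:
  assumes "finite V" "is_path V E u v p0"
  shows "weighted_dist V E w u v = ereal (pair_dist V E w {u, v})"
  using assms by (rule weighted_dist_attained[of V E u v p0 w]) (simp add: pair_dist_eq)

text \<open>A shortest path for \<open>w'\<close> competes for \<open>w\<close> as well, and its
  length changes by at most the l1-distance. Connectivity is public: without a path, both sides have
  the same junk value.\<close>

lemma pair_dist_le:
  assumes V: "finite V" and E: "finite E" and e: "card e = 2"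
  shows "pair_dist V E w e \<le> pair_dist V E w' e + edge_l1 E w w'"
proof -
  obtain u v where uv: "e = {u, v}" using e by (auto simp: card_2_iff)
  show ?thesis
  proof (cases "\<exists>p. is_path V E u v p")
    case True
    then obtain p0 where p0: "is_path V E u v p0" ..
    obtain p where p: "is_path V E u v p" "weighted_dist V E w' u v = ereal (path_weight w' p)"
      by (rule weighted_dist_attained[OF V p0])
    have "weighted_dist V E w u v \<le> ereal (path_weight w p)"
      unfolding weighted_dist_eq using p(1) by (intro INF_lower) simp
    then have "pair_dist V E w e \<le> path_weight w p"
      using weighted_dist_pair_dist[OF V p0, of w] uv by simp
    also have "\<dots> \<le> path_weight w' p + edge_l1 E w w'" using p(1) E by (rule path_weight_le)
    also have "path_weight w' p = pair_dist V E w' e"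
      using weighted_dist_pair_dist[OF V p0, of w'] uv p(2) by simp
    finally show ?thesis .
  next
    case False
    then show ?thesis using edge_l1_nonneg by (simp add: uv pair_dist_eq weighted_dist_infinite)
  qed
qed

lemma edge_l1_commute: "edge_l1 E w w' = edge_l1 E w' w"
  by (simp add: edge_l1_def abs_minus_commute)

lemma pair_dist_lipschitz:
  assumes "finite V" "finite E" "card e = 2"
  shows "\<bar>pair_dist V E w e - pair_dist V E w' e\<bar> \<le> edge_l1 E w w'"
  using pair_dist_le[OF assms, of w w'] pair_dist_le[OF assms, of w' w] by (simp add: edge_l1_commute)

text \<open>The weights enter \<open>edge_length\<close> only through the noisy weights and the noisy distances, which
  replace the bare noise here.\<close>

fun noisy_length :: "'v set \<Rightarrow> 'v set set \<Rightarrow> nat \<Rightarrow> 'v set list \<Rightarrow> 'v set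
    \<Rightarrow> ('v set \<Rightarrow> real) \<Rightarrow> ('v set \<Rightarrow> real) \<Rightarrow> (nat \<Rightarrow> nat \<Rightarrow> 'v matrix)
    \<Rightarrow> colour \<Rightarrow> 'v \<Rightarrow> 'v \<Rightarrow> ereal" where
  "noisy_length V E K Bs S red blue mats Red u v = (if {u, v} \<in> E then ereal (red {u, v}) else \<infinity>)"
| "noisy_length V E K Bs S red blue mats Blue u v =
     (if u \<in> S \<and> v \<in> S \<and> u \<noteq> v \<and> (\<exists>p. is_path V E u v p) then ereal (blue {u, v}) else \<infinity>)"
| "noisy_length V E K Bs S red blue mats Green u v =
     (INF t\<in>{t. t < length Bs \<and> u \<in> Bs ! t \<and> v \<in> Bs ! t}. median_of K (\<lambda>i. mats t i (u, v)))"

definition vertex_pairs :: "'v set \<Rightarrow> 'v set set" where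
  "vertex_pairs S = {e. e \<subseteq> S \<and> card e = 2}"

lemma finite_vertex_pairs: "finite S \<Longrightarrow> finite (vertex_pairs S)"
  by (rule finite_subset[of _ "Pow S"]) (auto simp: vertex_pairs_def)

lemma card_vertex_pairs:
  assumes "finite S"
  shows "real (card (vertex_pairs S)) \<le> (real (card S))\<^sup>2 / 2"
proof -
  have "card (vertex_pairs S) = card S choose 2" unfolding vertex_pairs_def using assms by (rule n_subsets)
  also have "real \<dots> \<le> (real (card S))\<^sup>2 / 2"
    by (cases "card S") (auto simp: choose_two power2_eq_square field_simps real_of_nat_div)
  finally show ?thesis .
qed

text \<open>Between different components, infinity plus noise is still infinity, which the path
  condition in \<open>noisy_length\<close> reproduces. The restricted functions are read only inside
  their domains: red edges lie in \<open>E\<close>, and blue ones join two distinct vertices of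
  \<open>S\<close>.\<close>

lemma edge_length_eq_noisy_length:
  assumes "finite V"
  shows "edge_length V E w K Bs S red blue mats =
    noisy_length V E K Bs S (\<lambda>e\<in>E. w e + red e) (\<lambda>e\<in>vertex_pairs S. pair_dist V E w e + blue e) mats"
proof (intro ext)
  fix c u v
  show "edge_length V E w K Bs S red blue mats c u v =
    noisy_length V E K Bs S (\<lambda>e\<in>E. w e + red e) (\<lambda>e\<in>vertex_pairs S. pair_dist V E w e + blue e) mats c u v"
  proof (cases c)
    case Blue
    then show ?thesis
      using weighted_dist_infinite[of V E u v w] weighted_dist_pair_dist[OF assms, of E u v _ w]
      by (auto simp: vertex_pairs_def)
  qed auto
qed

text \<open>Only the sigma-algebra counts: it is common to the bare noise, the shifted noise and the
  recursive outputs, so that measurability is shown once for all. A recursive run on a ball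
  \<open>B\<close> returns a matrix on \<open>V \<inter> B\<close>.\<close>

definition noise_space :: "'v set \<Rightarrow> 'v set set \<Rightarrow> nat \<Rightarrow> 'v set list \<Rightarrow> 'v set
    \<Rightarrow> (('v set \<Rightarrow> real) \<times> ('v set \<Rightarrow> real) \<times> (nat \<Rightarrow> nat \<Rightarrow> 'v matrix)) measure" where
  "noise_space V E K Bs S = PiM E (\<lambda>_. borel) \<Otimes>\<^sub>M (PiM (vertex_pairs S) (\<lambda>_. borel) \<Otimes>\<^sub>M
     PiM {..<length Bs} (\<lambda>t. PiM {..<K} (\<lambda>_. matrix_space (V \<inter> Bs ! t))))"

lemma measurable_noisy_length:
  assumes K: "K > 0" and uv: "u \<in> V" "v \<in> V"
  shows "(\<lambda>(red, blue, mats). noisy_length V E K Bs S red blue mats c u v) \<in> borel_measurable (noise_space V E K Bs S)"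
proof (cases c)
  case Red
  have "(\<lambda>x. ereal (fst x e)) \<in> borel_measurable (noise_space V E K Bs S)" if "e \<in> E" for e
    unfolding noise_space_def using that
    by (intro borel_measurable_ereal measurable_compose[OF measurable_fst measurable_component_singleton])
  then show ?thesis
    using Red by (cases "{u, v} \<in> E") (simp_all add: case_prod_beta')
next
  case Blue
  have "(\<lambda>x. ereal (fst (snd x) e)) \<in> borel_measurable (noise_space V E K Bs S)" if "e \<in> vertex_pairs S" for e
    unfolding noise_space_def using that
    by (intro borel_measurable_ereal
        measurable_compose[OF measurable_compose[OF measurable_snd measurable_fst] measurable_component_singleton])
  moreover have "{u, v} \<in> vertex_pairs S" if "u \<in> S" "v \<in> S" "u \<noteq> v"
    using that by (auto simp: vertex_pairs_def)
  ultimately have *: "(\<lambda>x. if C then ereal (fst (snd x) {u, v}) else \<infinity>) \<in> borel_measurable (noise_space V E K Bs S)"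
    if "C \<longrightarrow> u \<in> S \<and> v \<in> S \<and> u \<noteq> v" for C
    using that by (cases C) simp_all
  then show ?thesis
    unfolding Blue noisy_length.simps case_prod_beta' by (intro *) (intro impI, elim conjE, intro conjI)
next
  case Green
  let ?T = "{t. t < length Bs \<and> u \<in> Bs ! t \<and> v \<in> Bs ! t}"
  have "(\<lambda>x. INF t\<in>?T. median_of K (\<lambda>i. snd (snd x) t i (u, v))) \<in> borel_measurable (noise_space V E K Bs S)"
  proof (intro borel_measurable_INF measurable_median_of K)
    fix t i assume t: "t \<in> ?T" and i: "i < K"
    have 1: "(\<lambda>x. snd (snd x)) \<in> measurable (noise_space V E K Bs S)
        (PiM {..<length Bs} (\<lambda>t. PiM {..<K} (\<lambda>_. matrix_space (V \<inter> Bs ! t))))"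
      unfolding noise_space_def by measurable
    have 2: "(\<lambda>x. x t) \<in> measurable (PiM {..<length Bs} (\<lambda>t. PiM {..<K} (\<lambda>_. matrix_space (V \<inter> Bs ! t))))
        (PiM {..<K} (\<lambda>_. matrix_space (V \<inter> Bs ! t)))"
      using t by (intro measurable_component_singleton) auto
    have 3: "(\<lambda>x. x i) \<in> measurable (PiM {..<K} (\<lambda>_. matrix_space (V \<inter> Bs ! t))) (matrix_space (V \<inter> Bs ! t))"
      using i by (intro measurable_component_singleton) auto
    \<comment> \<open>The matrix for the ball has an entry at \<open>(u, v)\<close>, because
      \<open>?T\<close> contains only balls with both vertices.\<close>
    have 4: "(\<lambda>x. x (u, v)) \<in> borel_measurable (matrix_space (V \<inter> Bs ! t))"
      unfolding matrix_space_def using t uv by (intro measurable_component_singleton) auto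
    show "(\<lambda>x. snd (snd x) t i (u, v)) \<in> borel_measurable (noise_space V E K Bs S)"
      by (rule measurable_compose[OF measurable_compose[OF measurable_compose[OF 1 2] 3] 4])
  qed auto
  then show ?thesis using Green by (simp add: case_prod_beta')
qed

lemma measurable_restricted_dist_noisy:
  assumes "finite V" "K > 0"
  shows "(\<lambda>(red, blue, mats). restricted_dist V (noisy_length V E K Bs S red blue mats) r g)
    \<in> measurable (noise_space V E K Bs S) (matrix_space V)"
  unfolding case_prod_beta'
proof (rule measurable_restricted_dist[OF assms(1)])
  show "(\<lambda>x. noisy_length V E K Bs S (fst x) (fst (snd x)) (snd (snd x)) c u v) \<in> borel_measurable (noise_space V E K Bs S)"
    if "u \<in> V" "v \<in> V" for c u v
    using measurable_noisy_length[OF assms(2) that] by (simp add: case_prod_beta')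
qed


section \<open>One round\<close>

abbreviation shifted_Lap :: "real \<Rightarrow> real \<Rightarrow> real measure" where
  "shifted_Lap b c \<equiv> distr (Lap b) borel ((+) c)"

lemma prob_space_shifted_Lap: "b > 0 \<Longrightarrow> prob_space (shifted_Lap b c)"
  by (intro prob_space.prob_space_distr prob_space_Lap) auto

lemma dp_close_shifted_Lap:
  assumes "b > 0"
  shows "dp_close (\<bar>c - c'\<bar> / b) 0 (shifted_Lap b c) (shifted_Lap b c')"
  unfolding distr_Lap_shift_density[OF assms, of c c']
  using assms by (intro dp_close_density) (auto intro!: divide_right_mono)

text \<open>Used for the red edges, and for the blue edges in the pure setting and in the degenerate
  case of distance 0.\<close>

lemma dp_close_PiM_shifted_Lap:
  assumes I: "finite I" and b: "b > 0" and a: "(\<Sum>i\<in>I. \<bar>c i - c' i\<bar>) / b \<le> a"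
  shows "dp_close a 0 (PiM I (\<lambda>i. shifted_Lap b (c i))) (PiM I (\<lambda>i. shifted_Lap b (c' i)))"
proof -
  have "dp_close (\<Sum>i\<in>I. \<bar>c i - c' i\<bar> / b) (\<Sum>i\<in>I. 0) (PiM I (\<lambda>i. shifted_Lap b (c i))) (PiM I (\<lambda>i. shifted_Lap b (c' i)))"
    by (intro dp_close_PiM I dp_close_shifted_Lap b prob_space_shifted_Lap) auto
  then show ?thesis using a by (auto simp: sum_divide_distrib elim: dp_close_mono)
qed

text \<open>The Chernoff parameter \<open>l = 6 * Q / a\<close> turns the exponent into
  \<open>6 * a / 400 + 36 * Q / 400 - 2 * Q \<le> - Q\<close>.\<close>

lemma dp_close_PiM_shifted_Lap_advanced:
  fixes c c' :: "'i \<Rightarrow> real"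
  assumes I: "finite I" and card: "real (card I) \<le> L\<^sup>2 / 2" and L: "L > 0"
    and Q: "Q \<ge> 1" and a: "0 < a" "a \<le> 1" and b: "b > 0"
    and s: "s / b = a / (10 * L * sqrt Q)" and c: "\<And>i. i \<in> I \<Longrightarrow> \<bar>c i - c' i\<bar> \<le> s"
  shows "dp_close (a / 3) (exp (- Q)) (PiM I (\<lambda>i. shifted_Lap b (c i))) (PiM I (\<lambda>i. shifted_Lap b (c' i)))"
proof -
  define l where "l = 6 * Q / a"
  have l: "l > 0" using a Q by (simp add: l_def)
  have *: "dp_close (a / 3) (exp (real (card I) * (s / b)\<^sup>2 * (l + l\<^sup>2) / 2 - l * (a / 3)))
      (PiM I (\<lambda>i. shifted_Lap b (c i))) (PiM I (\<lambda>i. shifted_Lap b (c' i)))"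
  proof (rule dp_close_PiM_advanced[OF I _ _ _ distr_Lap_shift_density[OF b] _ l])
    fix i y assume i: "i \<in> I"
    have "\<bar>\<bar>y - c' i\<bar> - \<bar>y - c i\<bar>\<bar> \<le> s" using c[OF i] by linarith
    then show "\<bar>(\<bar>y - c' i\<bar> - \<bar>y - c i\<bar>) / b\<bar> \<le> s / b"
      using b by (simp add: divide_right_mono)
  qed (use b in \<open>auto intro: prob_space_shifted_Lap\<close>)
  have "real (card I) * (s / b)\<^sup>2 \<le> L\<^sup>2 / 2 * (s / b)\<^sup>2"
    by (intro mult_right_mono card) auto
  \<comment> \<open>By \<open>s\<close>, the square of \<open>s / b\<close> is
    \<open>a^2 / (100 * L^2 * Q)\<close>; the number of coordinates cancels
    \<open>L^2\<close>.\<close>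
  also have "\<dots> = a\<^sup>2 / (200 * Q)"
    unfolding s using L Q by (simp add: power_divide power_mult_distrib)
  finally have "real (card I) * (s / b)\<^sup>2 * ((l + l\<^sup>2) / 2) \<le> a\<^sup>2 / (200 * Q) * ((l + l\<^sup>2) / 2)"
    using l by (intro mult_right_mono) auto
  also have "\<dots> = 6 * a / 400 + 36 * Q / 400"
    using a Q by (simp add: l_def field_simps power2_eq_square)
  finally have "real (card I) * (s / b)\<^sup>2 * (l + l\<^sup>2) / 2 \<le> 6 * a / 400 + 36 * Q / 400"
    by (simp only: times_divide_eq_right)
  moreover have "l * (a / 3) = 2 * Q" using a by (simp add: l_def)
  ultimately have "real (card I) * (s / b)\<^sup>2 * (l + l\<^sup>2) / 2 - l * (a / 3) \<le> 6 * a / 400 + 36 * Q / 400 - 2 * Q"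
    by linarith
  \<comment> \<open>Since \<open>a \<le> 1 \<le> Q\<close>, the two positive terms together are at
    most \<open>42 * Q / 400\<close>.\<close>
  also have "\<dots> \<le> - Q" using a Q by simp
  finally show ?thesis by (intro dp_close_mono[OF *]) auto
qed

text \<open>Lets a single induction serve both settings: in the pure one all additive errors are
  multiples of \<open>\<delta> = 0\<close>, and in the approximate one the upper bound on \<delta>
  keeps the logarithm in \<open>blue_scale\<close> at least 1.\<close>

definition dp_params :: "dp_setting \<Rightarrow> real \<Rightarrow> bool" where
  "dp_params m \<delta> \<longleftrightarrow> (case m of Approx_DP \<Rightarrow> 0 < \<delta> \<and> \<delta> \<le> 1 / 10 | Pure_DP \<Rightarrow> \<delta> = 0)"

lemma dp_params_nonneg: "dp_params m \<delta> \<Longrightarrow> 0 \<le> \<delta>"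
  by (auto simp: dp_params_def split: dp_setting.splits)

lemma dp_params_divide:
  assumes "dp_params m \<delta>" "c \<ge> 1"
  shows "dp_params m (\<delta> / c)"
proof -
  have "\<delta> / c \<le> \<delta> / 1" using dp_params_nonneg[OF assms(1)] assms(2) by (intro divide_left_mono) auto
  then show ?thesis using assms by (auto simp: dp_params_def split: dp_setting.splits)
qed

text \<open>Provides the hypothesis \<open>Q \<ge> 1\<close> of the Chernoff bound and the
  positivity of the blue noise scale.\<close>

lemma ln_3K_div_ge_1:
  assumes "0 < \<delta>" "\<delta> \<le> 1 / 10" "K \<ge> (1::nat)"
  shows "ln (3 * real K / \<delta>) \<ge> 1"
proof -
  have "exp 1 \<le> (3::real)" by (rule exp_le)
  also have "\<dots> \<le> 3 * real K / 1" using assms(3) by simp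
  also have "\<dots> \<le> 3 * real K / \<delta>" using assms by (intro divide_left_mono) auto
  finally show ?thesis using assms by (subst ln_ge_iff) auto
qed

lemma blue_scale_pos:
  assumes "dp_params m \<delta>" "\<epsilon> > 0" "K \<ge> 1" "L \<ge> 1"
  shows "blue_scale m \<epsilon> \<delta> K L > 0"
proof (cases m)
  case Approx_DP
  then have "ln (3 * real K / \<delta>) \<ge> 1" using assms by (intro ln_3K_div_ge_1) (auto simp: dp_params_def)
  then show ?thesis using assms Approx_DP by (auto intro!: divide_pos_pos mult_pos_pos)
qed (use assms in auto)

text \<open>The blue edges may use one third of the budget of a round. Each distance moves by at
  most \<open>s\<close>, and the loss has to be proportional to \<open>s\<close> as well, in order
  to fit the strengthened induction.\<close>

lemma dp_close_blue:
  fixes c c' :: "'v set \<Rightarrow> real"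
  assumes m: "dp_params m \<delta>" and \<epsilon>: "0 < \<epsilon>" "\<epsilon> \<le> 1" and K: "K \<ge> 1" and L: "L \<ge> 1"
    and S: "finite S" "card S \<le> L" and s: "0 \<le> s" "s \<le> 1"
    and c: "\<And>e. e \<in> vertex_pairs S \<Longrightarrow> \<bar>c e - c' e\<bar> \<le> s"
  shows "dp_close (\<epsilon> * s / (3 * real K)) (\<delta> / (3 * real K))
    (PiM (vertex_pairs S) (\<lambda>e. shifted_Lap (blue_scale m \<epsilon> \<delta> K L) (c e)))
    (PiM (vertex_pairs S) (\<lambda>e. shifted_Lap (blue_scale m \<epsilon> \<delta> K L) (c' e)))"
    (is "dp_close _ _ (?P c) (?P c')")
proof -
  let ?b = "blue_scale m \<epsilon> \<delta> K L" and ?I = "vertex_pairs S"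
  have b: "?b > 0" using m \<epsilon>(1) K L by (rule blue_scale_pos)
  have I: "finite ?I" using S(1) by (rule finite_vertex_pairs)
  have "real (card ?I) \<le> (real (card S))\<^sup>2 / 2" using S(1) by (rule card_vertex_pairs)
  also have "\<dots> \<le> (real L)\<^sup>2 / 2" using S(2) by (intro divide_right_mono power_mono) auto
  finally have cI: "real (card ?I) \<le> (real L)\<^sup>2 / 2" .
  have sum: "(\<Sum>e\<in>?I. \<bar>c e - c' e\<bar>) \<le> (real L)\<^sup>2 / 2 * s"
    using sum_bounded_above[of ?I "\<lambda>e. \<bar>c e - c' e\<bar>" s] c mult_right_mono[OF cI s(1)] by simp
  have \<delta>: "0 \<le> \<delta>" using m by (rule dp_params_nonneg)
  show ?thesis
  proof (cases m)
    case Pure_DP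
    have "(\<Sum>e\<in>?I. \<bar>c e - c' e\<bar>) / ?b \<le> (real L)\<^sup>2 / 2 * s / ?b"
      using sum b by (intro divide_right_mono) auto
    \<comment> \<open>At most \<open>L^2 / 2\<close> coordinates with noise of scale
      \<open>10 * K * L^2 / \<epsilon>\<close>, so \<open>L\<close> drops out.\<close>
    also have "\<dots> = \<epsilon> * s / (20 * real K)" using Pure_DP K L \<epsilon> by (simp add: field_simps)
    also have "\<dots> \<le> \<epsilon> * s / (3 * real K)" using K \<epsilon> s by (intro divide_left_mono) auto
    finally have "dp_close (\<epsilon> * s / (3 * real K)) 0 (?P c) (?P c')"
      by (intro dp_close_PiM_shifted_Lap I b)
    then show ?thesis by (rule dp_close_mono) (use \<delta> in auto)
  next
    case Approx_DP
    show ?thesis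
    proof (cases "s = 0")
      case True
      then have "(\<Sum>e\<in>?I. \<bar>c e - c' e\<bar>) / ?b \<le> 0" using sum b by (simp add: divide_le_0_iff)
      then have "dp_close 0 0 (?P c) (?P c')" by (intro dp_close_PiM_shifted_Lap I b)
      then show ?thesis by (rule dp_close_mono) (use \<delta> \<epsilon> s in auto)
    next
      case False
      define Q where "Q = ln (3 * real K / \<delta>)"
      \<comment> \<open>This is the budget of the whole round. The Chernoff bound returns
        \<open>a / 3\<close>, and \<open>blue_scale\<close> is such that \<open>s / ?b\<close> has
        the form it requires.\<close>
      define a where "a = \<epsilon> * s / real K"
      have d: "0 < \<delta>" "\<delta> \<le> 1 / 10" using m Approx_DP by (auto simp: dp_params_def)
      have Q: "Q \<ge> 1" unfolding Q_def using d K by (rule ln_3K_div_ge_1)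
      have a0: "a > 0" using False s \<epsilon> K by (simp add: a_def)
      have "\<epsilon> * s \<le> 1 * 1" using \<epsilon> s by (intro mult_mono) auto
      then have a1: "a \<le> 1" using K by (simp add: a_def divide_le_eq)
      have "dp_close (a / 3) (exp (- Q)) (?P c) (?P c')"
      proof (rule dp_close_PiM_shifted_Lap_advanced[OF I cI _ Q a0 a1 b _ c])
        show "s / ?b = a / (10 * real L * sqrt Q)"
          using Approx_DP by (simp add: a_def Q_def field_simps)
      qed (use L in auto)
      moreover have "exp (- Q) = \<delta> / (3 * real K)"
        using d K by (simp add: Q_def exp_minus)
      ultimately show ?thesis by (simp add: a_def mult.commute)
    qed
  qed
qed

section \<open>The output of a round for given balls and sample\<close>

lemma sets_noise_space:
  assumes "\<And>t. sets (M t) = sets (matrix_space (V \<inter> Bs ! t))" "\<And>e. sets (P e) = sets borel" "\<And>e. sets (Q e) = sets borel"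
  shows "sets (PiM E P \<Otimes>\<^sub>M (PiM (vertex_pairs S) Q \<Otimes>\<^sub>M PiM {..<length Bs} (\<lambda>t. PiM {..<K} (\<lambda>_. M t)))) =
    sets (noise_space V E K Bs S)"
  unfolding noise_space_def using assms by (intro sets_pair_measure_cong sets_PiM_cong refl) auto

text \<open>Isolates the part of \<open>bw_round\<close> that reads the weights; the balls and the
  sample are arguments.\<close>

definition round_output :: "'v set \<Rightarrow> 'v set set \<Rightarrow> ('v set \<Rightarrow> real) \<Rightarrow> nat \<Rightarrow> real \<Rightarrow> real \<Rightarrow> real \<Rightarrow> real
    \<Rightarrow> ('v set \<Rightarrow> 'v matrix measure) \<Rightarrow> 'v set list \<Rightarrow> 'v set \<Rightarrow> 'v matrix measure" where
  "round_output V E w K b\<^sub>r b\<^sub>b max_red max_green rec Bs S =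
     distr (PiM E (\<lambda>_. Lap b\<^sub>r) \<Otimes>\<^sub>M (PiM (vertex_pairs S) (\<lambda>_. Lap b\<^sub>b) \<Otimes>\<^sub>M
              PiM {..<length Bs} (\<lambda>t. PiM {..<K} (\<lambda>_. rec (Bs ! t)))))
       (matrix_space V)
       (\<lambda>(red, blue, mats). restricted_dist V (edge_length V E w K Bs S red blue mats) max_red max_green)"

lemma measurable_shift_noise:
  assumes s: "sets M = sets M'"
  shows "(\<lambda>(red, blue, mats). (\<lambda>e\<in>E. w e + red e, \<lambda>e\<in>J. d e + blue e, mats))
    \<in> measurable (PiM E (\<lambda>_. borel) \<Otimes>\<^sub>M (PiM J (\<lambda>_. borel) \<Otimes>\<^sub>M M))
        (PiM E (\<lambda>_. borel :: real measure) \<Otimes>\<^sub>M (PiM J (\<lambda>_. borel :: real measure) \<Otimes>\<^sub>M M'))"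
proof -
  have [measurable]: "(\<lambda>x. x) \<in> measurable M M'" using s by (rule measurable_ident_sets)
  show ?thesis by measurable
qed

lemma measurable_round_output:
  assumes "finite V" "K > 0"
  shows "(\<lambda>(red, blue, mats). restricted_dist V (edge_length V E w K Bs S red blue mats) max_red max_green)
    \<in> measurable (noise_space V E K Bs S) (matrix_space V)"
proof -
  have "(\<lambda>(red, blue, mats). (\<lambda>e\<in>E. w e + red e, \<lambda>e\<in>vertex_pairs S. pair_dist V E w e + blue e, mats))
      \<in> measurable (noise_space V E K Bs S) (noise_space V E K Bs S)"
    unfolding noise_space_def by (rule measurable_shift_noise) simp
  from measurable_compose[OF this measurable_restricted_dist_noisy[OF assms]]
  show ?thesis by (simp add: edge_length_eq_noisy_length[OF assms(1)] case_prod_beta')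
qed

lemma round_output_in_space:
  assumes "finite V" "K > 0" "b\<^sub>r > 0" "b\<^sub>b > 0"
    and rec: "\<And>B. rec B \<in> space (prob_algebra (matrix_space (V \<inter> B)))"
  shows "round_output V E w K b\<^sub>r b\<^sub>b max_red max_green rec Bs S \<in> space (prob_algebra (matrix_space V))"
proof -
  let ?N = "PiM E (\<lambda>_. Lap b\<^sub>r) \<Otimes>\<^sub>M (PiM (vertex_pairs S) (\<lambda>_. Lap b\<^sub>b) \<Otimes>\<^sub>M
              PiM {..<length Bs} (\<lambda>t. PiM {..<K} (\<lambda>_. rec (Bs ! t))))"
  have r: "prob_space (rec B)" "sets (rec B) = sets (matrix_space (V \<inter> B))" for B
    using rec[of B] by (auto simp: space_prob_algebra)
  have "sets ?N = sets (noise_space V E K Bs S)" using r(2) by (intro sets_noise_space) auto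
  then have "(\<lambda>(red, blue, mats). restricted_dist V (edge_length V E w K Bs S red blue mats) max_red max_green)
      \<in> measurable ?N (matrix_space V)"
    using measurable_round_output[OF assms(1,2)] measurable_cong_sets by blast
  moreover have "prob_space ?N"
    by (intro prob_space_pair prob_space_PiM prob_space_Lap r assms)
  ultimately show ?thesis
    by (simp add: space_prob_algebra round_output_def prob_space.prob_space_distr)
qed

text \<open>The weights and distances move from the map into the noise distribution. What remains is
  a map that depends only on the topology, the balls and the sample, hence the same post-processing
  for both weightings.\<close>

lemma round_output_eq:
  assumes V: "finite V" and K: "K > 0" and b: "b\<^sub>r > 0" "b\<^sub>b > 0" and E: "finite E" and S: "finite S"
    and rec: "\<And>B. rec B \<in> space (prob_algebra (matrix_space (V \<inter> B)))"
  shows "round_output V E w K b\<^sub>r b\<^sub>b max_red max_green rec Bs S =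
    distr (PiM E (\<lambda>e. shifted_Lap b\<^sub>r (w e)) \<Otimes>\<^sub>M (PiM (vertex_pairs S) (\<lambda>e. shifted_Lap b\<^sub>b (pair_dist V E w e)) \<Otimes>\<^sub>M
              PiM {..<length Bs} (\<lambda>t. PiM {..<K} (\<lambda>_. rec (Bs ! t)))))
       (matrix_space V)
       (\<lambda>(red, blue, mats). restricted_dist V (noisy_length V E K Bs S red blue mats) max_red max_green)"
proof -
  define R where "R = PiM E (\<lambda>_. Lap b\<^sub>r)"
  define B where "B = PiM (vertex_pairs S) (\<lambda>_. Lap b\<^sub>b)"
  define M where "M = PiM {..<length Bs} (\<lambda>t. PiM {..<K} (\<lambda>_. rec (Bs ! t)))"
  define NR :: "('a set \<Rightarrow> real) measure" where "NR = PiM E (\<lambda>_. borel)"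
  define NB :: "('a set \<Rightarrow> real) measure" where "NB = PiM (vertex_pairs S) (\<lambda>_. borel)"
  define f where "f r = (\<lambda>e\<in>E. w e + r e)" for r
  define g where "g r = (\<lambda>e\<in>vertex_pairs S. pair_dist V E w e + r e)" for r
  let ?G = "\<lambda>(red, blue, mats). restricted_dist V (noisy_length V E K Bs S red blue mats) max_red max_green"
  have r: "prob_space (rec B)" "sets (rec B) = sets (matrix_space (V \<inter> B))" for B
    using rec[of B] by (auto simp: space_prob_algebra)
  have sRB: "sets R = sets NR" "sets B = sets NB"
    unfolding R_def B_def NR_def NB_def by (auto intro!: sets_PiM_cong)
  have f[measurable]: "f \<in> measurable R NR" unfolding measurable_cong_sets[OF sRB(1) refl] unfolding f_def NR_def by measurable
  have g[measurable]: "g \<in> measurable B NB" unfolding measurable_cong_sets[OF sRB(2) refl] unfolding g_def NB_def by measurable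
  have M: "prob_space M" unfolding M_def by (intro prob_space_PiM r)
  have pB: "prob_space B" unfolding B_def by (intro prob_space_PiM prob_space_Lap b)
  have dR: "PiM E (\<lambda>e. shifted_Lap b\<^sub>r (w e)) = distr R NR f"
    using distr_PiM_componentwise[OF E prob_space_Lap[OF b(1)], of "\<lambda>e. (+) (w e)" "\<lambda>_. borel"]
    by (simp add: R_def NR_def f_def[abs_def])
  have dB: "PiM (vertex_pairs S) (\<lambda>e. shifted_Lap b\<^sub>b (pair_dist V E w e)) = distr B NB g"
    using distr_PiM_componentwise[OF finite_vertex_pairs[OF S] prob_space_Lap[OF b(2)], of "\<lambda>e. (+) (pair_dist V E w e)" "\<lambda>_. borel"]
    by (simp add: B_def NB_def g_def[abs_def])
  have pr: "prob_space (distr (B \<Otimes>\<^sub>M M) (NB \<Otimes>\<^sub>M M) (\<lambda>(x, y). (g x, y)))"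
    by (intro prob_space.prob_space_distr prob_space_pair pB M) measurable
  \<comment> \<open>\<open>pair_measure_distr\<close> expects an image measure in both factors; the
    identity makes \<open>M\<close> one.\<close>
  have "distr B NB g \<Otimes>\<^sub>M M = distr B NB g \<Otimes>\<^sub>M distr M M (\<lambda>x. x)" by simp
  also have "\<dots> = distr (B \<Otimes>\<^sub>M M) (NB \<Otimes>\<^sub>M M) (\<lambda>(x, y). (g x, y))"
    using M g by (intro pair_measure_distr) (auto intro: prob_space_imp_sigma_finite)
  finally have "distr R NR f \<Otimes>\<^sub>M (distr B NB g \<Otimes>\<^sub>M M) =
      distr R NR f \<Otimes>\<^sub>M distr (B \<Otimes>\<^sub>M M) (NB \<Otimes>\<^sub>M M) (\<lambda>(x, y). (g x, y))" by simp
  also have "\<dots> = distr (R \<Otimes>\<^sub>M (B \<Otimes>\<^sub>M M)) (NR \<Otimes>\<^sub>M (NB \<Otimes>\<^sub>M M)) (\<lambda>(x, y). (f x, (\<lambda>(x, y). (g x, y)) y))"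
    using f g pr by (intro pair_measure_distr) (auto intro: prob_space_imp_sigma_finite)
  finally have eq: "distr R NR f \<Otimes>\<^sub>M (distr B NB g \<Otimes>\<^sub>M M) =
      distr (R \<Otimes>\<^sub>M (B \<Otimes>\<^sub>M M)) (NR \<Otimes>\<^sub>M (NB \<Otimes>\<^sub>M M)) (\<lambda>(x, y). (f x, (\<lambda>(x, y). (g x, y)) y))" .
  have "sets (NR \<Otimes>\<^sub>M (NB \<Otimes>\<^sub>M M)) = sets (noise_space V E K Bs S)"
    unfolding NR_def NB_def M_def using r(2) by (intro sets_noise_space) auto
  then have G: "?G \<in> measurable (NR \<Otimes>\<^sub>M (NB \<Otimes>\<^sub>M M)) (matrix_space V)"
    using measurable_restricted_dist_noisy[OF V K] measurable_cong_sets by blast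
  have m: "(\<lambda>(x, y). (f x, (\<lambda>(x, y). (g x, y)) y)) \<in> measurable (R \<Otimes>\<^sub>M (B \<Otimes>\<^sub>M M)) (NR \<Otimes>\<^sub>M (NB \<Otimes>\<^sub>M M))"
    by measurable
  show ?thesis
    unfolding dR dB M_def[symmetric] eq distr_distr[OF G m]
    unfolding round_output_def R_def[symmetric] B_def[symmetric] M_def[symmetric]
    by (simp add: comp_def case_prod_beta' edge_length_eq_noisy_length[OF V] f_def[symmetric] g_def[symmetric])
qed


section \<open>The recursion\<close>

lemma K_param_ge_1:
  assumes "n \<ge> 2"
  shows "K_param n \<ge> 1"
proof -
  have "ln (real n) > 0" using assms by simp
  then show ?thesis unfolding K_param_def by linarith
qed

lemma three_K_sq_ge_1: "K \<ge> (1::nat) \<Longrightarrow> 3 * (real K)\<^sup>2 \<ge> 1"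
  using one_le_power[of "real K" 2] by linarith

lemma T_R_param_pos:
  assumes "n \<ge> 2" "A * \<epsilon> * real n \<ge> 1"
  shows "T_param m A \<epsilon> n > 0" "R_param m A \<epsilon> n > 0"
proof -
  have "A * \<epsilon> * real n \<noteq> 0" "real n > 0" using assms by auto
  then show "T_param m A \<epsilon> n > 0" "R_param m A \<epsilon> n > 0"
    unfolding T_param_def R_param_def by (auto intro!: divide_pos_pos simp: powr_def)
qed

lemma L_param_ge_1:
  assumes "n \<ge> 2" "A * \<epsilon> * real n \<ge> 1"
  shows "L_param m A \<epsilon> n \<ge> 1"
proof -
  have "100 * ln (real n) * real n / T_param m A \<epsilon> n > 0"
    using T_R_param_pos(1)[OF assms] assms(1) by (auto intro!: divide_pos_pos mult_pos_pos)
  then show ?thesis unfolding L_param_def by linarith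
qed

lemma bw_round_eq_round_output:
  "bw_round m A pick V E w \<epsilon> \<delta> rec =
     (let n = card V; K = K_param n; T = T_param m A \<epsilon> n; R = R_param m A \<epsilon> n; L = L_param m A \<epsilon> n
      in carve n pick V E T R [] \<bind> (\<lambda>Bs.
         measure_pmf (pmf_of_set {S. S \<subseteq> V \<and> card S = min L n}) \<bind>
         round_output V E w K (3 * real K / \<epsilon>) (blue_scale m \<epsilon> \<delta> K L)
           (100 * R * ln (real n) + 100 * T / R) (100 * T / R) rec Bs))"
  by (simp add: bw_round_def round_output_def[abs_def] vertex_pairs_def Let_def)

lemma measurable_pmf_kernel:
  assumes "\<And>x. f x \<in> space (prob_algebra N)"
  shows "f \<in> measurable (measure_pmf p) (prob_algebra N)"
  using assms by simp

lemma bw_round_in_space: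
  assumes V: "finite V" and n: "card V \<ge> 2" "A * \<epsilon> * real (card V) \<ge> 1" and \<epsilon>: "\<epsilon> > 0" and m: "dp_params m \<delta>"
    and rec: "\<And>B. rec B \<in> space (prob_algebra (matrix_space (V \<inter> B)))"
  shows "bw_round m A pick V E w \<epsilon> \<delta> rec \<in> space (prob_algebra (matrix_space V))"
  unfolding bw_round_eq_round_output Let_def
proof (intro bind_in_space_prob_algebra)
  let ?C = "carve (card V) pick V E (T_param m A \<epsilon> (card V)) (R_param m A \<epsilon> (card V)) []"
  have C: "?C \<in> space (prob_algebra (count_space UNIV))"
    using V T_R_param_pos(2)[OF n] by (rule carve_in_space)
  then show "prob_space ?C" by (simp add: space_prob_algebra)
  have s: "sets ?C = sets (count_space UNIV)" using C by (simp add: space_prob_algebra)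
  show "(\<lambda>Bs. measure_pmf (pmf_of_set {S. S \<subseteq> V \<and> card S = min (L_param m A \<epsilon> (card V)) (card V)}) \<bind>
         round_output V E w (K_param (card V)) (3 * real (K_param (card V)) / \<epsilon>)
           (blue_scale m \<epsilon> \<delta> (K_param (card V)) (L_param m A \<epsilon> (card V)))
           (100 * R_param m A \<epsilon> (card V) * ln (real (card V)) + 100 * T_param m A \<epsilon> (card V) / R_param m A \<epsilon> (card V))
           (100 * T_param m A \<epsilon> (card V) / R_param m A \<epsilon> (card V)) rec Bs)
      \<in> measurable ?C (prob_algebra (matrix_space V))"
    unfolding measurable_cong_sets[OF s refl]
  proof (intro measurable_from_count_space bind_in_space_prob_algebra measurable_pmf_kernel round_output_in_space V rec)
    show "0 < blue_scale m \<epsilon> \<delta> (K_param (card V)) (L_param m A \<epsilon> (card V))"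
      by (intro blue_scale_pos m \<epsilon> K_param_ge_1 L_param_ge_1 n)
  qed (use K_param_ge_1[OF n(1)] \<epsilon> in \<open>auto intro: measure_pmf.prob_space_axioms\<close>)
qed

text \<open>These two sums keep the privacy loss and the additive error of the recursive calls under
  control, however many balls there are.\<close>

lemma disjoint_balls_sums:
  assumes V: "finite V" and E: "finite E" "\<And>e. e \<in> E \<Longrightarrow> e \<noteq> {}" and Bs: "disjoint_balls V Bs"
  shows "(\<Sum>t<length Bs. edge_l1 (induced_edges E (V \<inter> Bs ! t)) w w') \<le> edge_l1 E w w'"
    and "(\<Sum>t<length Bs. (real (card (V \<inter> Bs ! t)))\<^sup>2) \<le> (real (card V))\<^sup>2"
proof -
  let ?E = "\<lambda>t. induced_edges E (V \<inter> Bs ! t)" and ?B = "\<lambda>t. V \<inter> Bs ! t"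
  have d: "Bs ! s \<inter> Bs ! t = {}" if "s < length Bs" "t < length Bs" "s \<noteq> t" for s t
    using Bs that by (auto simp: disjoint_balls_def)
  \<comment> \<open>Edges are nonempty, so none of them lies in two disjoint balls.\<close>
  have dE: "?E s \<inter> ?E t = {}" if "s < length Bs" "t < length Bs" "s \<noteq> t" for s t
    using d[OF that] E(2) by (fastforce simp: induced_edges_def)
  have "(\<Sum>t<length Bs. edge_l1 (?E t) w w') = edge_l1 (\<Union>t<length Bs. ?E t) w w'"
    unfolding edge_l1_def using E(1) dE
    by (intro sum.UNION_disjoint[symmetric]) (auto simp: induced_edges_def)
  also have "\<dots> \<le> edge_l1 E w w'"
    unfolding edge_l1_def using E(1) by (intro sum_mono2) (auto simp: induced_edges_def)
  finally show "(\<Sum>t<length Bs. edge_l1 (?E t) w w') \<le> edge_l1 E w w'" .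
  \<comment> \<open>One factor of each square is bounded by \<open>card V\<close>; the other factors
    are sizes of disjoint sets and add up.\<close>
  have "(\<Sum>t<length Bs. (real (card (?B t)))\<^sup>2) \<le> (\<Sum>t<length Bs. real (card V) * real (card (?B t)))"
    unfolding power2_eq_square using V by (intro sum_mono mult_right_mono) (auto intro: card_mono)
  also have "\<dots> = real (card V) * real (\<Sum>t<length Bs. card (?B t))"
    by (simp add: sum_distrib_left)
  also have "(\<Sum>t<length Bs. card (?B t)) = card (\<Union>t<length Bs. ?B t)"
    using V d by (intro card_UN_disjoint[symmetric]) blast+
  also have "real (card V) * real \<dots> \<le> real (card V) * real (card V)"
    using V by (intro mult_left_mono) (auto intro: card_mono)
  finally show "(\<Sum>t<length Bs. (real (card (?B t)))\<^sup>2) \<le> (real (card V))\<^sup>2"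
    by (simp add: power2_eq_square)
qed

text \<open>For given balls and sample the three colours are independent, so their losses add up,
  each a third of the budget; computing the shortest paths is post-processing.\<close>

lemma dp_close_round_output:
  assumes G: "simple_graph V E" and \<epsilon>: "0 < \<epsilon>" "\<epsilon> \<le> 1" and m: "dp_params m \<delta>" and K: "K \<ge> 1" and L: "L \<ge> 1"
    and w: "edge_l1 E w w' \<le> 1" and S: "S \<subseteq> V" "card S \<le> L" and Bs: "disjoint_balls V Bs"
    and rec: "\<And>B. rec B \<in> space (prob_algebra (matrix_space (V \<inter> B)))"
    and rec': "\<And>B. rec' B \<in> space (prob_algebra (matrix_space (V \<inter> B)))"
    and close: "\<And>B. dp_close (\<epsilon> / (3 * (real K)\<^sup>2) * edge_l1 (induced_edges E (V \<inter> B)) w w')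
        (3 * (real (card (V \<inter> B)))\<^sup>2 * (\<delta> / (3 * (real K)\<^sup>2))) (rec B) (rec' B)"
  shows "dp_close (\<epsilon> * edge_l1 E w w' / real K) (\<delta> / (3 * real K) + (real (card V))\<^sup>2 * \<delta> / real K)
    (round_output V E w K (3 * real K / \<epsilon>) (blue_scale m \<epsilon> \<delta> K L) max_red max_green rec Bs S)
    (round_output V E w' K (3 * real K / \<epsilon>) (blue_scale m \<epsilon> \<delta> K L) max_red max_green rec' Bs S)"
proof -
  let ?s = "edge_l1 E w w'"
  define b\<^sub>r where "b\<^sub>r = 3 * real K / \<epsilon>"
  define b\<^sub>b where "b\<^sub>b = blue_scale m \<epsilon> \<delta> K L"
  have V: "finite V" using G by (simp add: simple_graph_def)
  have "E \<subseteq> Pow V" using G by (auto simp: simple_graph_def)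
  then have E: "finite E" using V finite_subset by blast
  have E2: "e \<noteq> {}" if "e \<in> E" for e using G that by (auto simp: simple_graph_def)
  have fS: "finite S" using S(1) V finite_subset by blast
  have br: "b\<^sub>r > 0" using K \<epsilon> by (simp add: b\<^sub>r_def)
  have bb: "b\<^sub>b > 0" unfolding b\<^sub>b_def using m \<epsilon>(1) K L by (rule blue_scale_pos)
  have K0: "K > 0" using K by simp
  have \<delta>: "\<delta> \<ge> 0" using m by (rule dp_params_nonneg)
  have s0: "?s \<ge> 0" by (rule edge_l1_nonneg)
  have r: "prob_space (rec B)" "sets (rec B) = sets (matrix_space (V \<inter> B))" for B
    using rec[of B] by (auto simp: space_prob_algebra)
  have r': "prob_space (rec' B)" "sets (rec' B) = sets (matrix_space (V \<inter> B))" for B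
    using rec'[of B] by (auto simp: space_prob_algebra)
  define P\<^sub>r where "P\<^sub>r w = PiM E (\<lambda>e. shifted_Lap b\<^sub>r (w e))" for w
  define P\<^sub>b where "P\<^sub>b w = PiM (vertex_pairs S) (\<lambda>e. shifted_Lap b\<^sub>b (pair_dist V E w e))" for w
  define P\<^sub>g where "P\<^sub>g rec = PiM {..<length Bs} (\<lambda>t. PiM {..<K} (\<lambda>_. rec (Bs ! t)))" for rec :: "'a set \<Rightarrow> 'a matrix measure"
  have red: "dp_close (\<epsilon> * ?s / (3 * real K)) 0 (P\<^sub>r w) (P\<^sub>r w')"
    unfolding P\<^sub>r_def by (rule dp_close_PiM_shifted_Lap[OF E br]) (simp add: edge_l1_def b\<^sub>r_def mult.commute)
  have blue: "dp_close (\<epsilon> * ?s / (3 * real K)) (\<delta> / (3 * real K)) (P\<^sub>b w) (P\<^sub>b w')"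
    unfolding P\<^sub>b_def b\<^sub>b_def
    by (rule dp_close_blue[OF m \<epsilon> K L fS S(2) s0 w]) (auto simp: vertex_pairs_def intro: pair_dist_lipschitz[OF V E])
  have "dp_close (\<Sum>t<length Bs. \<Sum>i<K. \<epsilon> / (3 * (real K)\<^sup>2) * edge_l1 (induced_edges E (V \<inter> Bs ! t)) w w')
      (\<Sum>t<length Bs. \<Sum>i<K. 3 * (real (card (V \<inter> Bs ! t)))\<^sup>2 * (\<delta> / (3 * (real K)\<^sup>2))) (P\<^sub>g rec) (P\<^sub>g rec')"
    unfolding P\<^sub>g_def
    by (intro dp_close_PiM close prob_space_PiM r(1) r'(1) sets_PiM_cong sum_nonneg) (use \<delta> r(2) r'(2) in auto)
  \<comment> \<open>The \<open>K\<close> runs on a ball use up one of the two factors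
    \<open>K\<close> in the recursive privacy parameter.\<close>
  moreover have "(\<Sum>t<length Bs. \<Sum>i<K. \<epsilon> / (3 * (real K)\<^sup>2) * edge_l1 (induced_edges E (V \<inter> Bs ! t)) w w') =
      \<epsilon> / (3 * real K) * (\<Sum>t<length Bs. edge_l1 (induced_edges E (V \<inter> Bs ! t)) w w')"
    using K by (simp add: sum_distrib_left power2_eq_square)
  moreover have "\<dots> \<le> \<epsilon> / (3 * real K) * ?s"
    using \<epsilon> K by (intro mult_left_mono disjoint_balls_sums(1)[OF V E E2 Bs]) auto
  \<comment> \<open>Likewise for the additive error, where the 3 of the induction hypothesis cancels
    the 3 in the recursive \<open>\<delta> / (3 * K^2)\<close>.\<close>
  moreover have "(\<Sum>t<length Bs. \<Sum>i<K. 3 * (real (card (V \<inter> Bs ! t)))\<^sup>2 * (\<delta> / (3 * (real K)\<^sup>2))) =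
      \<delta> / real K * (\<Sum>t<length Bs. (real (card (V \<inter> Bs ! t)))\<^sup>2)"
    using K by (simp add: sum_distrib_left power2_eq_square field_simps)
  moreover have "\<dots> \<le> \<delta> / real K * (real (card V))\<^sup>2"
    using \<delta> K by (intro mult_left_mono disjoint_balls_sums(2)[OF V E E2 Bs]) auto
  ultimately have green: "dp_close (\<epsilon> * ?s / (3 * real K)) ((real (card V))\<^sup>2 * \<delta> / real K) (P\<^sub>g rec) (P\<^sub>g rec')"
    by (elim dp_close_mono) (simp_all add: mult.commute)
  have p: "prob_space (P\<^sub>r w)" "prob_space (P\<^sub>b w)" "prob_space (P\<^sub>g rec)" "prob_space (P\<^sub>g rec')" for w
    unfolding P\<^sub>r_def P\<^sub>b_def P\<^sub>g_def by (intro prob_space_PiM prob_space_shifted_Lap br bb r(1) r'(1))+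
  have s: "sets (P\<^sub>r w) = sets (P\<^sub>r w')" "sets (P\<^sub>b w) = sets (P\<^sub>b w')" "sets (P\<^sub>g rec) = sets (P\<^sub>g rec')"
    unfolding P\<^sub>r_def P\<^sub>b_def P\<^sub>g_def using r(2) r'(2) by (auto intro!: sets_PiM_cong)
  have all: "dp_close (\<epsilon> * ?s / (3 * real K) + (\<epsilon> * ?s / (3 * real K) + \<epsilon> * ?s / (3 * real K)))
      (0 + (\<delta> / (3 * real K) + (real (card V))\<^sup>2 * \<delta> / real K))
      (P\<^sub>r w \<Otimes>\<^sub>M (P\<^sub>b w \<Otimes>\<^sub>M P\<^sub>g rec)) (P\<^sub>r w' \<Otimes>\<^sub>M (P\<^sub>b w' \<Otimes>\<^sub>M P\<^sub>g rec'))"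
    using \<delta> by (intro dp_close_pair red blue green prob_space_pair p s sets_pair_measure_cong) auto
  have "sets (P\<^sub>r w' \<Otimes>\<^sub>M (P\<^sub>b w' \<Otimes>\<^sub>M P\<^sub>g rec')) = sets (noise_space V E K Bs S)"
    unfolding P\<^sub>r_def P\<^sub>b_def P\<^sub>g_def using r'(2) by (intro sets_noise_space) auto
  then have "(\<lambda>(red, blue, mats). restricted_dist V (noisy_length V E K Bs S red blue mats) max_red max_green)
      \<in> measurable (P\<^sub>r w' \<Otimes>\<^sub>M (P\<^sub>b w' \<Otimes>\<^sub>M P\<^sub>g rec')) (matrix_space V)"
    using measurable_restricted_dist_noisy[OF V K0] measurable_cong_sets by blast
  from dp_close_distr[OF all this] s have
    "dp_close (\<epsilon> * ?s / (3 * real K) + (\<epsilon> * ?s / (3 * real K) + \<epsilon> * ?s / (3 * real K)))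
      (0 + (\<delta> / (3 * real K) + (real (card V))\<^sup>2 * \<delta> / real K))
      (round_output V E w K b\<^sub>r b\<^sub>b max_red max_green rec Bs S)
      (round_output V E w' K b\<^sub>r b\<^sub>b max_red max_green rec' Bs S)"
    unfolding round_output_eq[OF V K0 br bb E fS rec] round_output_eq[OF V K0 br bb E fS rec']
    unfolding P\<^sub>r_def P\<^sub>b_def P\<^sub>g_def by (simp cong: sets_pair_measure_cong)
  then show ?thesis
    unfolding b\<^sub>r_def[symmetric] b\<^sub>b_def[symmetric] by (rule dp_close_mono) (auto simp: field_simps)
qed

text \<open>Carving and sampling do not read the weights, so both weightings share these laws. It
  remains to compare the outputs for almost every choice of balls and sample.\<close>

lemma dp_close_bw_round:
  assumes G: "simple_graph V E" and n: "card V \<ge> 2" "A * \<epsilon> * real (card V) \<ge> 1"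
    and \<epsilon>: "0 < \<epsilon>" "\<epsilon> \<le> 1" and m: "dp_params m \<delta>" and K: "K = K_param (card V)"
    and w: "edge_l1 E w w' \<le> 1"
    and rec: "\<And>B. rec B \<in> space (prob_algebra (matrix_space (V \<inter> B)))"
    and rec': "\<And>B. rec' B \<in> space (prob_algebra (matrix_space (V \<inter> B)))"
    and close: "\<And>B. dp_close (\<epsilon> / (3 * (real K)\<^sup>2) * edge_l1 (induced_edges E (V \<inter> B)) w w')
        (3 * (real (card (V \<inter> B)))\<^sup>2 * (\<delta> / (3 * (real K)\<^sup>2))) (rec B) (rec' B)"
  shows "dp_close (\<epsilon> * edge_l1 E w w' / real K) (\<delta> / (3 * real K) + (real (card V))\<^sup>2 * \<delta> / real K)
    (bw_round m A pick V E w \<epsilon> \<delta> rec) (bw_round m A pick V E w' \<epsilon> \<delta> rec')"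
proof -
  let ?n = "card V"
  define L where "L = L_param m A \<epsilon> ?n"
  define T where "T = T_param m A \<epsilon> ?n"
  define R where "R = R_param m A \<epsilon> ?n"
  define p where "p = pmf_of_set {S. S \<subseteq> V \<and> card S = min L ?n}"
  define C where "C = carve ?n pick V E T R []"
  define out where "out w rec = round_output V E w K (3 * real K / \<epsilon>) (blue_scale m \<epsilon> \<delta> K L)
           (100 * R * ln (real ?n) + 100 * T / R) (100 * T / R) rec" for w rec
  have bw: "bw_round m A pick V E w \<epsilon> \<delta> rec = C \<bind> (\<lambda>Bs. measure_pmf p \<bind> out w rec Bs)" for w rec
    unfolding bw_round_eq_round_output Let_def C_def p_def out_def K T_def R_def L_def ..
  have V: "finite V" using G by (simp add: simple_graph_def)
  have K1: "K \<ge> 1" unfolding K using n(1) by (rule K_param_ge_1)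
  have L1: "L \<ge> 1" unfolding L_def using n by (rule L_param_ge_1)
  have R0: "R > 0" unfolding R_def using n by (rule T_R_param_pos)
  have out: "out w rec Bs S \<in> space (prob_algebra (matrix_space V))"
    if "\<And>B. rec B \<in> space (prob_algebra (matrix_space (V \<inter> B)))" for w rec Bs S
    unfolding out_def using K1 \<epsilon> by (intro round_output_in_space V that blue_scale_pos[OF m \<epsilon>(1) K1 L1]) auto
  have C: "C \<in> space (prob_algebra (count_space UNIV))"
    unfolding C_def using V R0 by (rule carve_in_space)
  then have pC: "prob_space C" and sC: "sets C = sets (count_space UNIV)" by (auto simp: space_prob_algebra)
  have inner: "(\<lambda>Bs. measure_pmf p \<bind> out w rec Bs) \<in> measurable C (prob_algebra (matrix_space V))"
    if "\<And>B. rec B \<in> space (prob_algebra (matrix_space (V \<inter> B)))" for w rec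
    unfolding measurable_cong_sets[OF sC refl]
    by (intro measurable_from_count_space bind_in_space_prob_algebra measurable_pmf_kernel out that
        measure_pmf.prob_space_axioms)
  have "disjoint_balls V []" by (simp add: disjoint_balls_def)
  then have disj: "AE Bs in C. disjoint_balls V Bs"
    unfolding C_def by (rule AE_carve_disjoint[OF V R0])
  \<comment> \<open>\<open>pmf_of_set\<close> has the intended support only for a nonempty finite
    set; capping the sample size at \<open>card V\<close> ensures that a sample exists.\<close>
  have "{S. S \<subseteq> V \<and> card S = min L ?n} \<noteq> {}"
    using obtain_subset_with_card_n[of "min L ?n" V] by (metis (mono_tags, lifting) empty_iff mem_Collect_eq min.cobounded2)
  then have "set_pmf p = {S. S \<subseteq> V \<and> card S = min L ?n}"
    unfolding p_def using V by (intro set_pmf_of_set) auto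
  then have pS: "AE S in measure_pmf p. S \<subseteq> V \<and> card S \<le> L"
    by (auto simp: AE_measure_pmf_iff)
  show ?thesis
    unfolding bw
  proof (rule dp_close_bind[OF pC inner[OF rec] inner[OF rec']], use disj in eventually_elim)
    case (elim Bs)
    show ?case
    proof (rule dp_close_bind[OF measure_pmf.prob_space_axioms measurable_pmf_kernel measurable_pmf_kernel],
        rule out[OF rec], rule out[OF rec'], use pS in eventually_elim)
      case (elim S)
      then show ?case
        unfolding out_def using \<open>disjoint_balls V Bs\<close>
        by (intro dp_close_round_output[OF G \<epsilon> m K1 L1 w _ _ _ rec rec' close]) auto
    qed
  qed
qed

section \<open>Induction over the recursive calls\<close>

lemma simple_graph_induced: "simple_graph V E \<Longrightarrow> simple_graph (V \<inter> B) (induced_edges E (V \<inter> B))"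
  by (auto simp: simple_graph_def induced_edges_def)

lemma measurable_median_matrix:
  assumes "K > 0"
  shows "(\<lambda>D. \<lambda>uv\<in>V \<times> V. median_of K (\<lambda>k. D k uv)) \<in> measurable (PiM {..<K} (\<lambda>_. matrix_space V)) (matrix_space V)"
  unfolding matrix_space_def
proof (intro measurable_restrict measurable_median_of assms)
  fix uv k assume "uv \<in> V \<times> V" "k < K"
  then show "(\<lambda>D. D k uv) \<in> borel_measurable (PiM {..<K} (\<lambda>_. PiM (V \<times> V) (\<lambda>_. borel)))"
    by (auto intro!: measurable_compose[of "\<lambda>D. D k" _ "PiM (V \<times> V) (\<lambda>_. borel)"] measurable_component_singleton)
qed

lemma restrict_in_matrix_space: "restrict D (V \<times> V) \<in> space (matrix_space V)"
  by (simp add: matrix_space_def space_PiM)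

lemma return_matrix_in_space: "return (matrix_space V) (restrict D (V \<times> V)) \<in> space (prob_algebra (matrix_space V))"
  by (simp add: space_prob_algebra prob_space_return restrict_in_matrix_space)

text \<open>Shown ahead of the privacy bound, because comparing products and mixtures presupposes
  that the recursive outputs are probability measures on the right space.\<close>

lemma bounded_weights_in_space:
  assumes "simple_graph V E" "0 < \<epsilon>" "dp_params m \<delta>"
  shows "bounded_weights m A pick dflt V E w \<epsilon> \<delta> \<in> space (prob_algebra (matrix_space V))"
  using assms
proof (induction m A pick dflt V E w \<epsilon> \<delta> rule: bounded_weights.induct)
  case (1 m A pick dflt V E w \<epsilon> \<delta>)
  let ?K = "K_param (card V)"
  show ?case
  proof (cases "card V \<le> 1 \<or> A * \<epsilon> * real (card V) < 1")
    case True
    then show ?thesis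
      \<comment> \<open>Fixing the vertex set confines the unfolding to the outer call; the
        recursive ones are at \<open>V \<inter> B\<close>.\<close>
      unfolding bounded_weights.simps[of _ _ _ _ V] using return_matrix_in_space[of V] by auto
  next
    case False
    then have n: "card V \<ge> 2" "A * \<epsilon> * real (card V) \<ge> 1" by auto
    have K1: "?K \<ge> 1" using n(1) by (rule K_param_ge_1)
    let ?rec = "\<lambda>B. bounded_weights m A pick dflt (V \<inter> B) (induced_edges E (V \<inter> B)) w
                    (\<epsilon> / (3 * (real ?K)\<^sup>2)) (\<delta> / (3 * (real ?K)\<^sup>2))"
    have "?rec B \<in> space (prob_algebra (matrix_space (V \<inter> B)))" for B
      using False "1.prems" K1 three_K_sq_ge_1[OF K1]
      by (intro "1.IH" simple_graph_induced dp_params_divide) auto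
    then have "bw_round m A pick V E w \<epsilon> \<delta> ?rec \<in> space (prob_algebra (matrix_space V))"
      using "1.prems" n by (intro bw_round_in_space) (auto simp: simple_graph_def)
    then have r: "prob_space (bw_round m A pick V E w \<epsilon> \<delta> ?rec)" "sets (bw_round m A pick V E w \<epsilon> \<delta> ?rec) = sets (matrix_space V)"
      by (auto simp: space_prob_algebra)
    let ?P = "PiM {..<?K} (\<lambda>_. bw_round m A pick V E w \<epsilon> \<delta> ?rec)"
    have s: "sets ?P = sets (PiM {..<?K} (\<lambda>_. matrix_space V))" using r(2) by (intro sets_PiM_cong) auto
    have "(\<lambda>D. \<lambda>uv\<in>V \<times> V. median_of ?K (\<lambda>k. D k uv)) \<in> measurable ?P (matrix_space V)"
      unfolding measurable_cong_sets[OF s refl] using K1 by (intro measurable_median_matrix) simp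
    moreover have "prob_space ?P" by (intro prob_space_PiM r(1))
    ultimately show ?thesis
      unfolding bounded_weights.simps[of _ _ _ _ V] using False
      by (simp add: space_prob_algebra prob_space.prob_space_distr)
  qed
qed

text \<open>The recursion hands the weighting on unrestricted and only shrinks the edge set.
  Therefore \<open>w'\<close> can stay fixed in the induction, and the hypothesis compares the same
  two weightings on the edges of a ball.\<close>

lemma dp_close_bounded_weights:
  assumes "simple_graph V E" "0 < \<epsilon>" "\<epsilon> \<le> 1" "dp_params m \<delta>" "edge_l1 E w w' \<le> 1"
  shows "dp_close (\<epsilon> * edge_l1 E w w') (3 * (real (card V))\<^sup>2 * \<delta>)
    (bounded_weights m A pick dflt V E w \<epsilon> \<delta>) (bounded_weights m A pick dflt V E w' \<epsilon> \<delta>)"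
  using assms
proof (induction m A pick dflt V E w \<epsilon> \<delta> rule: bounded_weights.induct)
  case (1 m A pick dflt V E w \<epsilon> \<delta>)
  let ?K = "K_param (card V)" and ?s = "edge_l1 E w w'"
  have \<delta>: "\<delta> \<ge> 0" using "1.prems" dp_params_nonneg by blast
  show ?case
  proof (cases "card V \<le> 1 \<or> A * \<epsilon> * real (card V) < 1")
    case True
    \<comment> \<open>Without recursion the output is a constant that does not involve the
      weights.\<close>
    then have "bounded_weights m A pick dflt V E w \<epsilon> \<delta> = bounded_weights m A pick dflt V E w' \<epsilon> \<delta>"
      unfolding bounded_weights.simps[of _ _ _ _ V] by auto
    then show ?thesis
      using "1.prems" \<delta> edge_l1_nonneg[of E w w'] by (auto intro!: dp_close_mono[OF dp_close_refl])
  next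
    case False
    then have n: "card V \<ge> 2" "A * \<epsilon> * real (card V) \<ge> 1" by auto
    have K1: "?K \<ge> 1" using n(1) by (rule K_param_ge_1)
    note K3 = three_K_sq_ge_1[OF K1]
    have E: "finite E" using "1.prems"(1) finite_subset[of E "Pow V"] by (auto simp: simple_graph_def)
    define rec where "rec w = (\<lambda>B. bounded_weights m A pick dflt (V \<inter> B) (induced_edges E (V \<inter> B)) w
                    (\<epsilon> / (3 * (real ?K)\<^sup>2)) (\<delta> / (3 * (real ?K)\<^sup>2)))" for w
    have eq: "bounded_weights m A pick dflt V E w \<epsilon> \<delta> =
        distr (PiM {..<?K} (\<lambda>_. bw_round m A pick V E w \<epsilon> \<delta> (rec w))) (matrix_space V)
          (\<lambda>D. \<lambda>uv\<in>V \<times> V. median_of ?K (\<lambda>k. D k uv))" for w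
      unfolding bounded_weights.simps[of _ _ _ _ V] using False by (auto simp: rec_def)
    have \<epsilon>3: "0 < \<epsilon> / (3 * (real ?K)\<^sup>2)" using "1.prems"(2) K3 by (intro divide_pos_pos) linarith+
    have "\<epsilon> / (3 * (real ?K)\<^sup>2) \<le> \<epsilon> / 1" using "1.prems" K1 K3 by (intro divide_left_mono) auto
    then have \<epsilon>1: "\<epsilon> / (3 * (real ?K)\<^sup>2) \<le> 1" using "1.prems" by simp
    have m3: "dp_params m (\<delta> / (3 * (real ?K)\<^sup>2))" using "1.prems"(4) K3 by (rule dp_params_divide)
    have G: "simple_graph (V \<inter> B) (induced_edges E (V \<inter> B))" for B
      using "1.prems"(1) by (rule simple_graph_induced)
    have rec: "rec w B \<in> space (prob_algebra (matrix_space (V \<inter> B)))" for w B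
      unfolding rec_def using G \<epsilon>3 m3 by (rule bounded_weights_in_space)
    \<comment> \<open>Hands the bound 1 on the l1-distance down to the recursive calls.\<close>
    have sub: "edge_l1 (induced_edges E (V \<inter> B)) w w' \<le> ?s" for B
      unfolding edge_l1_def using E by (intro sum_mono2) (auto simp: induced_edges_def)
    have close: "dp_close (\<epsilon> / (3 * (real ?K)\<^sup>2) * edge_l1 (induced_edges E (V \<inter> B)) w w')
        (3 * (real (card (V \<inter> B)))\<^sup>2 * (\<delta> / (3 * (real ?K)\<^sup>2))) (rec w B) (rec w' B)" for B
      unfolding rec_def using False "1.prems"(5) sub[of B] G \<epsilon>3 \<epsilon>1 m3 by (intro "1.IH") auto
    have rounds: "bw_round m A pick V E w \<epsilon> \<delta> (rec w) \<in> space (prob_algebra (matrix_space V))" for w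
      using "1.prems" n rec by (intro bw_round_in_space) (auto simp: simple_graph_def)
    then have p: "prob_space (bw_round m A pick V E w \<epsilon> \<delta> (rec w))"
      and s: "sets (bw_round m A pick V E w \<epsilon> \<delta> (rec w)) = sets (matrix_space V)" for w
      by (auto simp: space_prob_algebra)
    let ?P = "\<lambda>w. PiM {..<?K} (\<lambda>_. bw_round m A pick V E w \<epsilon> \<delta> (rec w))"
    have sP: "sets (?P w) = sets (PiM {..<?K} (\<lambda>_. matrix_space V))" for w using s by (intro sets_PiM_cong) auto
    have "dp_close (\<Sum>k<?K. \<epsilon> * ?s / real ?K) (\<Sum>k<?K. \<delta> / (3 * real ?K) + (real (card V))\<^sup>2 * \<delta> / real ?K) (?P w) (?P w')"
      using \<delta> s p
      by (intro dp_close_PiM dp_close_bw_round[OF "1.prems"(1) n "1.prems"(2,3,4) refl "1.prems"(5) rec rec close]) auto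
    moreover have "(\<lambda>D. \<lambda>uv\<in>V \<times> V. median_of ?K (\<lambda>k. D k uv)) \<in> measurable (?P w') (matrix_space V)"
      unfolding measurable_cong_sets[OF sP refl] using K1 by (intro measurable_median_matrix) simp
    ultimately have "dp_close (\<Sum>k<?K. \<epsilon> * ?s / real ?K) (\<Sum>k<?K. \<delta> / (3 * real ?K) + (real (card V))\<^sup>2 * \<delta> / real ?K)
        (bounded_weights m A pick dflt V E w \<epsilon> \<delta>) (bounded_weights m A pick dflt V E w' \<epsilon> \<delta>)"
      unfolding eq by (rule dp_close_distr) (simp only: sP)
    moreover have "(\<Sum>k<?K. \<epsilon> * ?s / real ?K) = \<epsilon> * ?s" using K1 by simp
    moreover have "(\<Sum>k<?K. \<delta> / (3 * real ?K) + (real (card V))\<^sup>2 * \<delta> / real ?K) = (1 / 3 + (real (card V))\<^sup>2) * \<delta>"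
      using K1 by (simp add: field_simps)
    \<comment> \<open>The blue errors of all rounds contribute the \<open>1 / 3\<close>, which
      \<open>card V \<ge> 2\<close> absorbs into the factor 3.\<close>
    moreover have "(1 / 3 + (real (card V))\<^sup>2) * \<delta> \<le> 3 * (real (card V))\<^sup>2 * \<delta>"
      using \<delta> power_mono[of 2 "real (card V)" 2] n(1) by (intro mult_right_mono) auto
    ultimately show ?thesis by (auto elim: dp_close_mono)
  qed
qed

lemma differentially_private_bounded_weights:
  assumes "simple_graph V E" "0 < \<epsilon>" "\<epsilon> \<le> 1" "dp_params m \<delta>"
  shows "differentially_private (bounded_weightings E A) (adjacent_weightings E) (matrix_space V)
    (\<lambda>w. bounded_weights m A pick dflt V E w \<epsilon> \<delta>) \<epsilon> (3 * (real (card V))\<^sup>2 * \<delta>)"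
  unfolding differentially_private_def
proof (intro conjI ballI impI)
  have "bounded_weights m A pick dflt V E w \<epsilon> \<delta> \<in> space (prob_algebra (matrix_space V))" for w
    using assms by (intro bounded_weights_in_space)
  then show p: "prob_space (bounded_weights m A pick dflt V E w \<epsilon> \<delta>)"
    and s: "sets (bounded_weights m A pick dflt V E w \<epsilon> \<delta>) = sets (matrix_space V)" for w
    by (auto simp: space_prob_algebra)
  fix w w' S assume "adjacent_weightings E w w'" and S: "S \<in> sets (matrix_space V)"
  then have w: "edge_l1 E w w' \<le> 1" by (simp add: adjacent_weightings_def edge_l1_def)
  have "\<epsilon> * edge_l1 E w w' \<le> \<epsilon>" using w assms(2) by (simp add: mult_left_le)
  then have "dp_close \<epsilon> (3 * (real (card V))\<^sup>2 * \<delta>)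
      (bounded_weights m A pick dflt V E w \<epsilon> \<delta>) (bounded_weights m A pick dflt V E w' \<epsilon> \<delta>)"
    by (intro dp_close_mono[OF dp_close_bounded_weights[OF assms w]]) auto
  then show "measure (bounded_weights m A pick dflt V E w \<epsilon> \<delta>) S
      \<le> exp \<epsilon> * measure (bounded_weights m A pick dflt V E w' \<epsilon> \<delta>) S + 3 * (real (card V))\<^sup>2 * \<delta>"
    using p s S dp_params_nonneg[OF assms(4)] by (intro dp_close_measure) auto
qed

theorem theorem5p11:
  fixes V :: "'v set" and E :: "'v set set" and A \<epsilon> \<delta> :: real
    and pick :: "'v centre_rule" and dflt :: "'v default_rule"
  assumes "simple_graph V E" and "V \<noteq> {}" and "A > 0"
    and "0 < \<epsilon>" and "\<epsilon> \<le> 1" and "0 < \<delta>" and "\<delta> \<le> 1 / 10"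
    and "\<And>U F Bs C. C \<noteq> {} \<Longrightarrow> pick U F Bs C \<in> C"
  shows "differentially_private (bounded_weightings E A) (adjacent_weightings E) (matrix_space V)
           (\<lambda>w. bounded_weights Approx_DP A pick dflt V E w \<epsilon> \<delta>) \<epsilon> (3 * (real (card V))\<^sup>2 * \<delta>)
       \<and> differentially_private (bounded_weightings E A) (adjacent_weightings E) (matrix_space V)
           (\<lambda>w. bounded_weights Pure_DP A pick dflt V E w \<epsilon> 0) \<epsilon> 0"
  using differentially_private_bounded_weights[OF assms(1,4,5), of Approx_DP \<delta> A pick dflt]
    differentially_private_bounded_weights[OF assms(1,4,5), of Pure_DP 0 A pick dflt] assms(6,7)
  by (simp add: dp_params_def)

end
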